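(* Let $\pi^T$ be the online risky policy with threshold $T$, which at time $t$ uses both servers ($u_t=1$) if $0<x_t<T$ and only the free server ($u_t=0$) otherwise. For any $(D,\epsilon)\in\mathcal R$, the policy $\pi^T$ is $(D,\epsilon)$-feasible if the threshold $T$ satisfies $$T\ \ge\ T^*=\begin{cases}\dfrac1{\alpha_1-\alpha_0}\Big[\log\big(\tfrac\beta\epsilon\big)-\alpha_0D\Big],& \text{if } D\ge\bar D,\\[2mm] \dfrac1{\alpha_1}\log\left(\dfrac{\epsilon+\beta(1-e^{-\alpha_1D})-1}{\epsilon-e^{-\alpha_1D}}\right),&\text{if } D\le\bar D,\end{cases}$$ where $\beta=\frac{\alpha_1}{\alpha_0(1-\frac{\alpha_0}2)}$ and $\bar D=\frac1{\alpha_1}\log\big(\frac\beta\epsilon\big)$.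
   Context: Media streaming model with infinite file size. Let $R_0>1$, $R_c>0$, $R_1=R_0+R_c$. Let $N_t$ and $N^c_t$ be independent Poisson processes of rates $R_0$ (free server) and $R_c$ (costly server). With initial buffer size $D$ and actions $u_t\in\{0,1\}$ ($u_t=1$ if both servers are used at time $t$, $u_t=0$ if only the free one is used), the buffer size is $$x_t = D+N_t+\int_0^t u_\tau\, dN^c_\tau - t .$$ A policy $\pi$ chooses $u_t$ as a function of the history of buffer sizes up to time $t$ and of past actions. The interruption probability of $\pi$ is $p^\pi(D)=\mathbf P\{\min_{t\ge0}x_t\le 0\mid x_0=D\}$. The policy is $(D,\epsilon)$-feasible if $p^\pi(D)\le\epsilon$, where $\epsilon\in(0,1)$. For $R>1$ let $\bar r(R)=\sup\{r:\ r+R(e^{-r}-1)=0\}$, and put $\alpha_0=\bar r(R_0)$, $\alpha_1=\bar r(R_1)$. Let $$\mathcal R=\Big\{(D,\epsilon):\ \tfrac1{\alpha_1}\log\tfrac1\epsilon\le D\le\tfrac1{\alpha_0}\log\tfrac1\epsilon\Big\}.$$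
   Formalization: Assumes α0 < 2, since otherwise β is undefined or negative and log(β/ε), D̄ and T* have no meaning; T* is read as +∞ where ε = e^{-α1 D}; and the integral uses the action just before each arrival, as the literal equation has no solution near T. *)

theory Defs
  imports "HOL-Probability.Probability"
begin

section \<open>Poisson arrivals\<close>

text \<open>
  Time is \<^typ>\<open>real\<close>, restricted to \<open>t \<ge> 0\<close>. The paths are counting paths for every \<open>\<omega>\<close>; on
  \<^typ>\<open>nat\<close> (discrete topology) right continuity means being locally constant to the right.
  By monotonicity the truncated difference in the increments is the true one.
\<close>

definition poisson_process :: "'a measure \<Rightarrow> real \<Rightarrow> (real \<Rightarrow> 'a \<Rightarrow> nat) \<Rightarrow> bool" where
  "poisson_process M R N \<longleftrightarrow>
     (\<forall>t\<ge>0. N t \<in> measurable M (count_space UNIV)) \<and>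
     (\<forall>\<omega>\<in>space M. N 0 \<omega> = 0 \<and>
        (\<forall>s t. 0 \<le> s \<longrightarrow> s \<le> t \<longrightarrow> N s \<omega> \<le> N t \<omega>) \<and>
        (\<forall>t\<ge>0. ((\<lambda>s. N s \<omega>) \<longlongrightarrow> N t \<omega>) (at_right t))) \<and>
     (\<forall>s t. 0 \<le> s \<longrightarrow> s < t \<longrightarrow>
        distr M (count_space UNIV) (\<lambda>\<omega>. N t \<omega> - N s \<omega>)
          = measure_pmf (poisson_pmf (R * (t - s)))) \<and>
     (\<forall>n (t :: nat \<Rightarrow> real). 0 \<le> t 0 \<longrightarrow> (\<forall>i<n. t i \<le> t (Suc i)) \<longrightarrow>
        prob_space.indep_vars M (\<lambda>_. count_space UNIV)
          (\<lambda>i \<omega>. N (t (Suc i)) \<omega> - N (t i) \<omega>) {..<n})"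

definition indep_processes ::
    "'a measure \<Rightarrow> (real \<Rightarrow> 'a \<Rightarrow> nat) \<Rightarrow> (real \<Rightarrow> 'a \<Rightarrow> nat) \<Rightarrow> bool" where
  "indep_processes M N N' \<longleftrightarrow>
     prob_space.indep_var M
       (Pi\<^sub>M {0..} (\<lambda>_. count_space UNIV)) (\<lambda>\<omega>. \<lambda>t\<in>{0..}. N t \<omega>)
       (Pi\<^sub>M {0..} (\<lambda>_. count_space UNIV)) (\<lambda>\<omega>. \<lambda>t\<in>{0..}. N' t \<omega>)"


section \<open>Policies and the controlled buffer\<close>

text \<open>
  \<open>\<pi> t x u\<close> is the action at time \<open>t\<close>, given a buffer path \<open>x\<close> and an action path \<open>u\<close>.
\<close>

type_synonym policy = "real \<Rightarrow> (real \<Rightarrow> real) \<Rightarrow> (real \<Rightarrow> nat) \<Rightarrow> nat"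

definition is_policy :: "policy \<Rightarrow> bool" where
  "is_policy \<pi> \<longleftrightarrow>
     (\<forall>t\<ge>0. \<forall>x u. \<pi> t x u \<in> {0, 1}) \<and>
     (\<forall>t\<ge>0. \<forall>x x' u u'. (\<forall>s\<in>{0..t}. x s = x' s) \<longrightarrow> (\<forall>s\<in>{0..<t}. u s = u' s) \<longrightarrow>
        \<pi> t x u = \<pi> t x' u')"

text \<open>
  The integral of the actions over \<open>(0, t]\<close> against a counting path \<open>n\<close>, which is the sum over
  the (finitely many) jump times of \<open>n\<close> weighted by the jump sizes. An arrival at time \<open>\<tau>\<close> is
  governed by the action in force just before it, that is, the left limit of \<open>u\<close> at \<open>\<tau>\<close>. The
  value \<open>u \<tau>\<close> itself is based on the buffer size after the arrival: with it, the equation would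
  have no solution for a threshold policy when an arrival occurs less than one unit below the
  threshold.
\<close>

definition action_integral :: "(real \<Rightarrow> nat) \<Rightarrow> (real \<Rightarrow> nat) \<Rightarrow> real \<Rightarrow> nat" where
  "action_integral u n t =
     (\<Sum>\<tau> | 0 < \<tau> \<and> \<tau> \<le> t \<and> n \<tau> \<noteq> Lim (at_left \<tau>) n.
        Lim (at_left \<tau>) u * (n \<tau> - Lim (at_left \<tau>) n))"

definition controlled_buffer ::
    "'a measure \<Rightarrow> (real \<Rightarrow> 'a \<Rightarrow> nat) \<Rightarrow> (real \<Rightarrow> 'a \<Rightarrow> nat) \<Rightarrow> policy \<Rightarrow> real \<Rightarrow>
     (real \<Rightarrow> 'a \<Rightarrow> real) \<Rightarrow> (real \<Rightarrow> 'a \<Rightarrow> nat) \<Rightarrow> bool" where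
  "controlled_buffer M N Nc \<pi> D x u \<longleftrightarrow>
     (\<forall>\<omega>\<in>space M. \<forall>t\<ge>0.
        u t \<omega> = \<pi> t (\<lambda>s. x s \<omega>) (\<lambda>s. u s \<omega>) \<and>
        x t \<omega> = D + real (N t \<omega>)
                  + real (action_integral (\<lambda>s. u s \<omega>) (\<lambda>s. Nc s \<omega>) t) - t)"

definition interruption :: "'a measure \<Rightarrow> (real \<Rightarrow> 'a \<Rightarrow> real) \<Rightarrow> 'a set" where
  "interruption M x = {\<omega> \<in> space M. \<exists>t\<ge>0. x t \<omega> \<le> 0}"

text \<open>
  Feasibility includes that the policy does control the buffer (a solution of the buffer equation
  exists) and that the interruption event is measurable, so that the bound is never vacuous: an
  unsolvable equation would make the universal statement empty, and \<^const>\<open>measure\<close> is \<open>0\<close> on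
  non-measurable sets.
\<close>

definition feasible ::
    "'a measure \<Rightarrow> (real \<Rightarrow> 'a \<Rightarrow> nat) \<Rightarrow> (real \<Rightarrow> 'a \<Rightarrow> nat) \<Rightarrow> policy \<Rightarrow> real \<Rightarrow> real \<Rightarrow> bool" where
  "feasible M N Nc \<pi> D \<epsilon> \<longleftrightarrow>
     is_policy \<pi> \<and>
     (\<exists>x u. controlled_buffer M N Nc \<pi> D x u) \<and>
     (\<forall>x u. controlled_buffer M N Nc \<pi> D x u \<longrightarrow>
        interruption M x \<in> sets M \<and> measure M (interruption M x) \<le> \<epsilon>)"

text \<open>For \<open>T = \<infinity>\<close> both servers are used as long as the buffer is nonempty.\<close>

definition risky_policy :: "ereal \<Rightarrow> policy" where
  "risky_policy T = (\<lambda>t x u. if 0 < x t \<and> ereal (x t) < T then 1 else 0)"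


section \<open>Exponents and threshold\<close>

definition rbar :: "real \<Rightarrow> real" where
  "rbar R = Sup {r. r + R * (exp (- r) - 1) = 0}"

definition nontrivial_region :: "real \<Rightarrow> real \<Rightarrow> (real \<times> real) set" where
  "nontrivial_region \<alpha>0 \<alpha>1 =
     {(D, \<epsilon>). 0 < \<epsilon> \<and> \<epsilon> < 1 \<and> 1 / \<alpha>1 * ln (1 / \<epsilon>) \<le> D \<and> D \<le> 1 / \<alpha>0 * ln (1 / \<epsilon>)}"

definition risky_beta :: "real \<Rightarrow> real \<Rightarrow> real" where
  "risky_beta \<alpha>0 \<alpha>1 = \<alpha>1 / (\<alpha>0 * (1 - \<alpha>0 / 2))"

definition risky_Dbar :: "real \<Rightarrow> real \<Rightarrow> real \<Rightarrow> real" where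
  "risky_Dbar \<alpha>0 \<alpha>1 \<epsilon> = 1 / \<alpha>1 * ln (risky_beta \<alpha>0 \<alpha>1 / \<epsilon>)"

definition Tstar_large :: "real \<Rightarrow> real \<Rightarrow> real \<Rightarrow> real \<Rightarrow> ereal" where
  "Tstar_large \<alpha>0 \<alpha>1 D \<epsilon> =
     ereal (1 / (\<alpha>1 - \<alpha>0) * (ln (risky_beta \<alpha>0 \<alpha>1 / \<epsilon>) - \<alpha>0 * D))"

text \<open>
  On the boundary \<open>D = ln (1 / \<epsilon>) / \<alpha>1\<close> of the region the denominator is \<open>0\<close> and the numerator
  is positive, so the threshold is \<open>\<infinity>\<close> there (division by \<open>0\<close> on \<^typ>\<open>real\<close> would give \<open>0\<close>).
\<close>

definition Tstar_small :: "real \<Rightarrow> real \<Rightarrow> real \<Rightarrow> real \<Rightarrow> ereal" where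
  "Tstar_small \<alpha>0 \<alpha>1 D \<epsilon> =
     (if \<epsilon> = exp (- \<alpha>1 * D) then \<infinity>
      else ereal (1 / \<alpha>1 *
        ln ((\<epsilon> + risky_beta \<alpha>0 \<alpha>1 * (1 - exp (- \<alpha>1 * D)) - 1) / (\<epsilon> - exp (- \<alpha>1 * D)))))"

definition Tstar :: "real \<Rightarrow> real \<Rightarrow> real \<Rightarrow> real \<Rightarrow> ereal" where
  "Tstar \<alpha>0 \<alpha>1 D \<epsilon> =
     (if D \<ge> risky_Dbar \<alpha>0 \<alpha>1 \<epsilon> then Tstar_large \<alpha>0 \<alpha>1 D \<epsilon> else Tstar_small \<alpha>0 \<alpha>1 D \<epsilon>)"

text \<open>The two cases agree where they overlap, so their order in \<open>Tstar\<close> is immaterial.\<close>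

lemma Tstar_cases_agree:
  assumes "0 < \<alpha>0" "\<alpha>0 < \<alpha>1" "\<alpha>0 < 2" "0 < \<epsilon>" and D: "D = risky_Dbar \<alpha>0 \<alpha>1 \<epsilon>"
  shows "Tstar_large \<alpha>0 \<alpha>1 D \<epsilon> = Tstar_small \<alpha>0 \<alpha>1 D \<epsilon>"
proof -
  define b where "b = risky_beta \<alpha>0 \<alpha>1"
  have "\<alpha>0 * (1 - \<alpha>0 / 2) < \<alpha>1"
    using assms by (smt (verit) divide_pos_pos mult_left_le)
  moreover have "0 < \<alpha>0 * (1 - \<alpha>0 / 2)" using assms by simp
  ultimately have b: "b > 1" unfolding b_def risky_beta_def by (simp add: divide_simps)
  have aD: "\<alpha>1 * D = ln (b / \<epsilon>)" using assms by (simp add: D risky_Dbar_def b_def)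
  have e: "exp (- \<alpha>1 * D) = \<epsilon> / b" using aD b \<open>0 < \<epsilon>\<close> by (simp add: exp_minus)
  have ne: "\<epsilon> \<noteq> \<epsilon> / b" using b \<open>0 < \<epsilon>\<close> by (simp add: field_simps)
  have "(\<epsilon> + b * (1 - \<epsilon> / b) - 1) / (\<epsilon> - \<epsilon> / b) = (b - 1) / (\<epsilon> * (b - 1) / b)"
    using b by (simp add: field_simps)
  also have "\<dots> = b / \<epsilon>" using b by simp
  finally have small: "Tstar_small \<alpha>0 \<alpha>1 D \<epsilon> = ereal (1 / \<alpha>1 * ln (b / \<epsilon>))"
    using ne by (simp add: Tstar_small_def b_def[symmetric] e[simplified])
  have "1 / (\<alpha>1 - \<alpha>0) * (ln (b / \<epsilon>) - \<alpha>0 * D) = D"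
    using assms by (simp add: aD[symmetric] field_simps)
  moreover have "1 / \<alpha>1 * ln (b / \<epsilon>) = D" using assms by (simp add: aD[symmetric])
  ultimately show ?thesis using small by (simp add: Tstar_large_def b_def[symmetric])
qed

end

theory Submission
  imports Defs
begin

text \<open>
  The function \<open>V\<close> that equals \<open>a * exp (- \<alpha>1 * x) + (1 - a)\<close> below the threshold and
  \<open>c * exp (- \<alpha>0 * (x - T))\<close> above it, with \<open>c = \<beta> * exp (- \<alpha>1 * T)\<close> and \<open>a\<close> chosen to make it
  continuous, dominates the indicator of the negative half-line, and the threshold \<open>T\<^sup>*\<close> is exactly
  the condition \<open>V D \<le> \<epsilon>\<close>. It is a supermartingale along the controlled buffer: each of its two
  branches, used with the arrival rate of its own region, is an exact exponential martingale, the
  lower branch dominates \<open>V\<close> everywhere, and the upper one dominates \<open>V\<close> down to some distance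
  below \<open>T\<close>, which is where the factor \<open>1 - \<alpha>0 / 2\<close> of \<open>\<beta>\<close> is used.

  No continuous-time martingale theory is needed. The buffer is compared with the chain that updates
  the action only at multiples of a mesh \<open>h\<close>. For \<^emph>\<open>every\<close> sample path, the chain agrees with the
  buffer at the grid points of a bounded time interval as soon as \<open>h\<close> is small enough, and for small
  \<open>h\<close> the function \<open>V\<close> is an exact supermartingale of the chain. This also exhibits the interruption
  event as a countable combination of events of the chain, hence as measurable.
\<close>

section \<open>Counting paths\<close>

definition counting_path :: "(real \<Rightarrow> nat) \<Rightarrow> bool" where
  "counting_path n \<longleftrightarrow> n 0 = 0 \<and> (\<forall>s t. 0 \<le> s \<longrightarrow> s \<le> t \<longrightarrow> n s \<le> n t) \<and>
     (\<forall>t\<ge>0. (n \<longlongrightarrow> n t) (at_right t))"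

text \<open>The index set of the sum in \<open>action_integral\<close>, so that the integral can be
  handled as a sum over jumps.\<close>

definition jump_times :: "(real \<Rightarrow> nat) \<Rightarrow> real \<Rightarrow> real set" where
  "jump_times n t = {\<tau>. 0 < \<tau> \<and> \<tau> \<le> t \<and> n \<tau> \<noteq> Lim (at_left \<tau>) n}"

definition jump_size :: "(real \<Rightarrow> nat) \<Rightarrow> real \<Rightarrow> nat" where
  "jump_size n \<tau> = n \<tau> - Lim (at_left \<tau>) n"

lemma counting_path_mono: "counting_path n \<Longrightarrow> 0 \<le> s \<Longrightarrow> s \<le> t \<Longrightarrow> n s \<le> n t"
  by (auto simp: counting_path_def)

lemma Lim_at_left_eq:
  fixes f :: "real \<Rightarrow> 'b::t2_space"
  assumes "eventually (\<lambda>s. f s = l) (at_left \<tau>)"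
  shows "Lim (at_left \<tau>) f = l"
  using assms by (intro tendsto_Lim tendsto_eventually) auto

lemma counting_path_right:
  assumes "counting_path n" "0 \<le> t"
  obtains b where "t < b" "\<And>s. t \<le> s \<Longrightarrow> s < b \<Longrightarrow> n s = n t"
proof -
  have "(n \<longlongrightarrow> n t) (at_right t)" using assms by (auto simp: counting_path_def)
  hence "eventually (\<lambda>s. n s = n t) (at_right t)" by (simp add: tendsto_discrete)
  then obtain b where "t < b" "\<And>s. t < s \<Longrightarrow> s < b \<Longrightarrow> n s = n t"
    by (auto simp: eventually_at_right_field)
  thus thesis using that[of b] by (metis order_le_less)
qed

text \<open>Before \<open>\<tau>\<close> the path takes finitely many values, all at most
  \<open>n \<tau>\<close>. By monotonicity it is constant from a point where the largest of them is
  attained.\<close>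

lemma counting_path_left:
  assumes n: "counting_path n" and "0 < \<tau>"
  obtains a where "0 \<le> a" "a < \<tau>" "\<And>s. a \<le> s \<Longrightarrow> s < \<tau> \<Longrightarrow> n s = Lim (at_left \<tau>) n"
proof -
  let ?S = "n ` {0..<\<tau>}"
  have "?S \<subseteq> {..n \<tau>}" using counting_path_mono[OF n] by auto
  hence fin: "finite ?S" by (rule finite_subset) simp
  moreover have "?S \<noteq> {}" using \<open>0 < \<tau>\<close> by auto
  ultimately have "Max ?S \<in> ?S" by (rule Max_in)
  then obtain a where a: "0 \<le> a" "a < \<tau>" "n a = Max ?S" by auto
  have const: "n s = n a" if "a \<le> s" "s < \<tau>" for s
  proof -
    have "n s \<le> Max ?S" using fin that a by (intro Max_ge) auto
    thus ?thesis using a counting_path_mono[OF n, of a s] that by simp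
  qed
  have "Lim (at_left \<tau>) n = n a"
  proof (rule Lim_at_left_eq)
    show "eventually (\<lambda>s. n s = n a) (at_left \<tau>)"
      unfolding eventually_at_left_field using a(2) const by (metis less_imp_le)
  qed
  thus thesis using that[of a] a(1,2) const by metis
qed

lemma counting_path_Lim_le:
  assumes "counting_path n" "0 \<le> s" "s < \<tau>"
  shows "n s \<le> Lim (at_left \<tau>) n" "Lim (at_left \<tau>) n \<le> n \<tau>"
proof -
  from assms have "0 < \<tau>" by simp
  then obtain a where a: "0 \<le> a" "a < \<tau>" "\<And>s. a \<le> s \<Longrightarrow> s < \<tau> \<Longrightarrow> n s = Lim (at_left \<tau>) n"
    using counting_path_left[OF assms(1)] by blast
  have "n (max a s) = Lim (at_left \<tau>) n" using a(3)[of "max a s"] a assms by simp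
  thus "n s \<le> Lim (at_left \<tau>) n" "Lim (at_left \<tau>) n \<le> n \<tau>"
    using counting_path_mono[OF assms(1), of s "max a s"]
      counting_path_mono[OF assms(1), of "max a s" \<tau>] a(1,2) assms(2,3) by simp_all
qed

lemma jump_less:
  assumes "counting_path n" "0 \<le> s" "s < \<tau>" "\<tau> \<in> jump_times n t"
  shows "n s < n \<tau>"
  using counting_path_Lim_le[OF assms(1-3)] assms(4) by (auto simp: jump_times_def)

text \<open>A counting path rises strictly at each jump, so it maps the jump times up to
  \<open>t\<close> injectively into \<open>{..n t}\<close>.\<close>

lemma finite_jump_times:
  assumes "counting_path n" shows "finite (jump_times n t)"
proof (rule finite_imageD)
  have "n ` jump_times n t \<subseteq> {..n t}"
    using counting_path_mono[OF assms] by (auto simp: jump_times_def)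
  thus "finite (n ` jump_times n t)" by (rule finite_subset) simp
  show "inj_on n (jump_times n t)"
  proof (rule linorder_inj_onI')
    fix i j assume "i \<in> jump_times n t" "j \<in> jump_times n t" "i < j"
    thus "n i \<noteq> n j" using jump_less[OF assms, of i j t] by (auto simp: jump_times_def)
  qed
qed

text \<open>Induction on the increment \<open>n t - n s\<close>: the last jump is removed and the
  argument continues from a point \<open>q\<close> shortly before it.\<close>

lemma sum_jump_size:
  assumes n: "counting_path n" and "0 \<le> s" "s \<le> t"
  shows "n s + (\<Sum>\<tau>\<in>jump_times n t \<inter> {s<..}. jump_size n \<tau>) = n t"
  using \<open>s \<le> t\<close>
proof (induction "n t - n s" arbitrary: t rule: less_induct)
  case less
  show ?case
  proof (cases "n t = n s")
    case True
    have "jump_times n t \<inter> {s<..} = {}"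
    proof (intro equals0I)
      fix \<tau> assume t: "\<tau> \<in> jump_times n t \<inter> {s<..}"
      hence "n s < n \<tau>" using jump_less[OF n \<open>0 \<le> s\<close>, of \<tau> t] by simp
      moreover have "n \<tau> \<le> n t"
        using t \<open>0 \<le> s\<close> by (intro counting_path_mono[OF n]) (auto simp: jump_times_def)
      ultimately show False using True by simp
    qed
    thus ?thesis using True by simp
  next
    case False
    \<comment> \<open>The last jump is the first time at which the final value \<open>n t\<close> is
      reached; right continuity shows that this infimum is attained.\<close>
    define U where "U = {r. s \<le> r \<and> n r = n t}"
    have U: "t \<in> U" "bdd_below U" using less.prems by (auto simp: U_def bdd_below_def)
    define \<tau> where "\<tau> = Inf U"
    have st: "s \<le> \<tau>" unfolding \<tau>_def using U by (intro cInf_greatest) (auto simp: U_def)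
    have tt: "\<tau> \<le> t" unfolding \<tau>_def using U by (intro cInf_lower)
    obtain b where b: "\<tau> < b" "\<And>r. \<tau> \<le> r \<Longrightarrow> r < b \<Longrightarrow> n r = n \<tau>"
      using counting_path_right[OF n] st \<open>0 \<le> s\<close> by (metis order_trans)
    obtain r where "r \<in> U" "r < b" using b(1) U unfolding \<tau>_def by (metis cInf_less_iff empty_iff)
    moreover from this have "\<tau> \<le> r" unfolding \<tau>_def using U by (intro cInf_lower)
    ultimately have nt: "n \<tau> = n t" using b(2)[of r] by (simp add: U_def)
    with False have st': "s < \<tau>" using st by (metis order_le_less)
    obtain a where a: "0 \<le> a" "a < \<tau>" "\<And>s. a \<le> s \<Longrightarrow> s < \<tau> \<Longrightarrow> n s = Lim (at_left \<tau>) n"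
      using counting_path_left[OF n, of \<tau>] st' \<open>0 \<le> s\<close> by (metis order_le_less_trans)
    define q where "q = max a s"
    have q: "0 \<le> q" "s \<le> q" "q < \<tau>" "n q = Lim (at_left \<tau>) n"
      using a st' by (auto simp: q_def)
    have "q \<notin> U" using q(3) U unfolding \<tau>_def by (metis cInf_lower linorder_not_le)
    hence lt: "n q < n \<tau>"
      using counting_path_mono[OF n q(1), of \<tau>] q nt by (auto simp: U_def)
    have ns: "n s \<le> n q" using counting_path_mono[OF n] q \<open>0 \<le> s\<close> by blast
    have split: "jump_times n t \<inter> {s<..} = insert \<tau> (jump_times n q \<inter> {s<..})"
    proof (intro equalityI subsetI)
      fix \<sigma> assume \<sigma>: "\<sigma> \<in> jump_times n t \<inter> {s<..}"
      hence pos: "0 < \<sigma>" "\<sigma> \<le> t" by (auto simp: jump_times_def)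
      have "\<not> \<tau> < \<sigma>"
        using jump_less[OF n, of \<tau> \<sigma> t] counting_path_mono[OF n, of \<sigma> t] \<sigma> pos nt st \<open>0 \<le> s\<close> by auto
      moreover have "\<not> (q < \<sigma> \<and> \<sigma> < \<tau>)"
        using jump_less[OF n q(1), of \<sigma> t] \<sigma> a(3)[of \<sigma>] q by (auto simp: q_def)
      ultimately show "\<sigma> \<in> insert \<tau> (jump_times n q \<inter> {s<..})"
        using \<sigma> by (auto simp: jump_times_def)
    next
      fix \<sigma> assume "\<sigma> \<in> insert \<tau> (jump_times n q \<inter> {s<..})"
      thus "\<sigma> \<in> jump_times n t \<inter> {s<..}"
        using lt q(3,4) st' tt \<open>0 \<le> s\<close> by (auto simp: jump_times_def)
    qed
    have "\<tau> \<notin> jump_times n q" using q by (auto simp: jump_times_def)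
    hence "n s + (\<Sum>\<tau>\<in>jump_times n t \<inter> {s<..}. jump_size n \<tau>)
        = jump_size n \<tau> + (n s + (\<Sum>\<tau>\<in>jump_times n q \<inter> {s<..}. jump_size n \<tau>))"
      unfolding split using finite_jump_times[OF n] by simp
    also have "\<dots> = jump_size n \<tau> + n q"
      using less.hyps[of q] lt ns q(2) nt by simp
    also have "\<dots> = n t" using lt q nt by (simp add: jump_size_def)
    finally show ?thesis .
  qed
qed

section \<open>Buffer paths driven by two counting paths\<close>

text \<open>\<open>w \<tau>\<close> is the amount accepted from the arrivals of \<open>m\<close> at time \<open>\<tau>\<close>.\<close>

definition buffer :: "(real \<Rightarrow> nat) \<Rightarrow> (real \<Rightarrow> nat) \<Rightarrow> real \<Rightarrow> (real \<Rightarrow> nat) \<Rightarrow> real \<Rightarrow> real" where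
  "buffer n m D w t = D + real (n t) + real (\<Sum>\<tau>\<in>jump_times m t. w \<tau>) - t"

text \<open>The left limit of \<open>buffer\<close>, written through the weights of strictly earlier
  jumps only, so that the condition in \<open>buffer_solution\<close> is a recursion along the
  jumps.\<close>

definition buffer_left :: "(real \<Rightarrow> nat) \<Rightarrow> (real \<Rightarrow> nat) \<Rightarrow> real \<Rightarrow> (real \<Rightarrow> nat) \<Rightarrow> real \<Rightarrow> real" where
  "buffer_left n m D w t =
     D + real (Lim (at_left t) n) + real (\<Sum>\<tau>\<in>jump_times m t \<inter> {..<t}. w \<tau>) - t"

definition buffer_solution ::
    "(real \<Rightarrow> nat) \<Rightarrow> (real \<Rightarrow> nat) \<Rightarrow> real \<Rightarrow> (real \<Rightarrow> bool) \<Rightarrow> (real \<Rightarrow> nat) \<Rightarrow> bool" where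
  "buffer_solution n m D P w \<longleftrightarrow>
     (\<forall>t. \<forall>\<tau>\<in>jump_times m t. w \<tau> = of_bool (P (buffer_left n m D w \<tau>)) * jump_size m \<tau>)"

section \<open>Local behaviour, existence and uniqueness of buffer solutions\<close>

lemma jump_times_const:
  assumes m: "counting_path m" and "0 \<le> s" "s \<le> t" "m s = m t"
  shows "jump_times m t = jump_times m s"
proof -
  have "\<tau> \<le> s" if "\<tau> \<in> jump_times m t" for \<tau>
  proof (rule ccontr)
    assume "\<not> \<tau> \<le> s"
    hence "m s < m \<tau>" using jump_less[OF m \<open>0 \<le> s\<close> _ that] by simp
    moreover have "m \<tau> \<le> m t" using that by (intro counting_path_mono[OF m]) (auto simp: jump_times_def)
    ultimately show False using assms by simp
  qed
  thus ?thesis using assms by (auto simp: jump_times_def)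
qed

text \<open>Shortly before \<open>t\<close> neither path moves, so the buffer only drains at unit
  rate. It approaches its left limit strictly from above, which later decides between
  \<open><\<close> and \<open>\<le>\<close> at the switching points.\<close>

lemma buffer_at_left:
  assumes n: "counting_path n" and m: "counting_path m" and "0 < t"
  obtains a where "0 \<le> a" "a < t"
    "\<And>s. a \<le> s \<Longrightarrow> s < t \<Longrightarrow> buffer n m D w s = buffer_left n m D w t + (t - s)"
proof -
  obtain a where a: "0 \<le> a" "a < t" "\<And>s. a \<le> s \<Longrightarrow> s < t \<Longrightarrow> n s = Lim (at_left t) n"
    using counting_path_left[OF n \<open>0 < t\<close>] by blast
  obtain b where b: "0 \<le> b" "b < t" "\<And>s. b \<le> s \<Longrightarrow> s < t \<Longrightarrow> m s = Lim (at_left t) m"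
    using counting_path_left[OF m \<open>0 < t\<close>] by blast
  show thesis
  proof (rule that[of "max a b"])
    fix s assume s: "max a b \<le> s" "s < t"
    have "jump_times m t \<inter> {..<t} = jump_times m s"
    proof (intro equalityI subsetI)
      fix \<tau> assume \<tau>: "\<tau> \<in> jump_times m t \<inter> {..<t}"
      have "\<not> s < \<tau>"
        using jump_less[OF m, of s \<tau> t] b(3)[of s] b(3)[of \<tau>] s b(1) \<tau> by auto
      thus "\<tau> \<in> jump_times m s" using \<tau> by (auto simp: jump_times_def)
    qed (use s in \<open>auto simp: jump_times_def\<close>)
    thus "buffer n m D w s = buffer_left n m D w t + (t - s)"
      using a(3)[of s] s by (simp add: buffer_def buffer_left_def)
  qed (use a b in auto)
qed

lemma buffer_at_right:
  assumes n: "counting_path n" and m: "counting_path m" and "0 \<le> t"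
  obtains b where "t < b" "\<And>s. t \<le> s \<Longrightarrow> s < b \<Longrightarrow> buffer n m D w s = buffer n m D w t - (s - t)"
proof -
  obtain a where a: "t < a" "\<And>s. t \<le> s \<Longrightarrow> s < a \<Longrightarrow> n s = n t"
    using counting_path_right[OF n \<open>0 \<le> t\<close>] by blast
  obtain b where b: "t < b" "\<And>s. t \<le> s \<Longrightarrow> s < b \<Longrightarrow> m s = m t"
    using counting_path_right[OF m \<open>0 \<le> t\<close>] by blast
  show thesis
  proof (rule that[of "min a b"])
    fix s assume s: "t \<le> s" "s < min a b"
    have "jump_times m s = jump_times m t"
      using jump_times_const[OF m \<open>0 \<le> t\<close> s(1)] b(2)[of s] s by simp
    thus "buffer n m D w s = buffer n m D w t - (s - t)"
      using a(2)[of s] s by (simp add: buffer_def)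
  qed (use a b in auto)
qed

lemma buffer_left_cong:
  assumes "\<And>\<tau>. \<tau> \<in> jump_times m t \<Longrightarrow> \<tau> < t \<Longrightarrow> w \<tau> = w' \<tau>"
  shows "buffer_left n m D w t = buffer_left n m D w' t"
  unfolding buffer_left_def using assms by (auto intro!: sum.cong)

text \<open>Lets induction on the values of \<open>m\<close> stand in for induction along the jump
  times.\<close>

lemma jump_times_less_iff:
  assumes "counting_path m" "\<sigma> \<in> jump_times m t" "\<tau> \<in> jump_times m t'"
  shows "m \<sigma> < m \<tau> \<longleftrightarrow> \<sigma> < \<tau>"
  using assms jump_less[OF assms(1), of \<sigma> \<tau>] counting_path_mono[OF assms(1), of \<tau> \<sigma>]
  by (force simp: jump_times_def not_less)

text \<open>
  Recursion over the jump times: the restriction \<open>m \<tau> < m t\<close>, which is \<open>\<tau> < t\<close> when \<open>t\<close> is a jump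
  time, makes it terminate.
\<close>

function buffer_weight ::
    "(real \<Rightarrow> nat) \<Rightarrow> (real \<Rightarrow> nat) \<Rightarrow> real \<Rightarrow> (real \<Rightarrow> bool) \<Rightarrow> real \<Rightarrow> nat" where
  "buffer_weight n m D P t =
     of_bool (P (D + real (Lim (at_left t) n)
       + real (\<Sum>\<tau>\<in>{\<tau> \<in> jump_times m t. m \<tau> < m t}. buffer_weight n m D P \<tau>) - t)) * jump_size m t"
  by pat_completeness auto
termination by (relation "Wellfounded.measure (\<lambda>(n, m, D, P, t). m t)") auto

declare buffer_weight.simps [simp del]

lemma buffer_solution_exists:
  assumes m: "counting_path m"
  shows "buffer_solution n m D P (buffer_weight n m D P)"
  unfolding buffer_solution_def
proof (intro allI ballI)
  fix t \<tau> assume \<tau>: "\<tau> \<in> jump_times m t"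
  have "{\<sigma> \<in> jump_times m \<tau>. m \<sigma> < m \<tau>} = jump_times m \<tau> \<inter> {..<\<tau>}"
    using jump_times_less_iff[OF m _ \<tau>] by auto
  thus "buffer_weight n m D P \<tau>
      = of_bool (P (buffer_left n m D (buffer_weight n m D P) \<tau>)) * jump_size m \<tau>"
    by (subst buffer_weight.simps) (simp add: buffer_left_def)
qed

text \<open>Strong induction on \<open>m \<tau>\<close>: acceptance at a jump depends only on the
  weights of earlier jumps.\<close>

lemma buffer_solution_unique:
  assumes m: "counting_path m"
    and w: "buffer_solution n m D P w" and w': "buffer_solution n m D P w'"
    and "\<tau> \<in> jump_times m t"
  shows "w \<tau> = w' \<tau>"
  using \<open>\<tau> \<in> jump_times m t\<close>
proof (induction "m \<tau>" arbitrary: \<tau> t rule: less_induct)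
  case less
  have "buffer_left n m D w \<tau> = buffer_left n m D w' \<tau>"
    using less jump_times_less_iff[OF m _ less.prems] by (intro buffer_left_cong) blast
  moreover have "w \<tau> = of_bool (P (buffer_left n m D w \<tau>)) * jump_size m \<tau>"
    "w' \<tau> = of_bool (P (buffer_left n m D w' \<tau>)) * jump_size m \<tau>"
    using w w' less.prems unfolding buffer_solution_def by blast+
  ultimately show ?case by simp
qed

lemma buffer_solution_eq:
  assumes "counting_path m" "buffer_solution n m D P w" "buffer_solution n m D P w'"
  shows "buffer n m D w t = buffer n m D w' t"
  unfolding buffer_def using buffer_solution_unique[OF assms] by (auto intro!: sum.cong)

text \<open>
  With this, the threshold policy may be replaced by one that also uses the costly server while the
  buffer is negative, without changing the interruption event.
\<close>

lemma buffer_solution_transfer: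
  assumes n: "counting_path n" and m: "counting_path m"
    and w: "buffer_solution n m D P w" and w': "buffer_solution n m D P' w'"
    and PP: "\<And>y. 0 \<le> y \<Longrightarrow> P y \<longleftrightarrow> P' y"
    and pos: "\<And>t. 0 \<le> t \<Longrightarrow> 0 < buffer n m D w t"
  shows "buffer n m D w t = buffer n m D w' t"
proof -
  \<comment> \<open>A positive path has nonnegative left limits, where \<open>P\<close> and
    \<open>P'\<close> agree; hence \<open>w\<close> also solves the equation for
    \<open>P'\<close>.\<close>
  have "0 \<le> buffer_left n m D w t" if t: "0 < t" for t
  proof -
    obtain a where a: "0 \<le> a" "a < t"
        "\<And>s. a \<le> s \<Longrightarrow> s < t \<Longrightarrow> buffer n m D w s = buffer_left n m D w t + (t - s)"
      using buffer_at_left[OF n m t] by blast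
    show ?thesis
    proof (rule ccontr)
      assume neg: "\<not> 0 \<le> buffer_left n m D w t"
      \<comment> \<open>At time \<open>t + buffer_left n m D w t\<close> the unit-rate descent would
        already have reached zero.\<close>
      define s where "s = max a (t + buffer_left n m D w t)"
      have "a \<le> s" "s < t" using neg a by (auto simp: s_def)
      hence "0 < buffer_left n m D w t + (t - s)" using pos[of s] a(1) a(3)[of s] by simp
      thus False by (simp add: s_def)
    qed
  qed
  hence "buffer_solution n m D P' w"
    using w PP unfolding buffer_solution_def by (auto simp: jump_times_def)
  thus ?thesis using buffer_solution_eq[OF m _ w'] by blast
qed

section \<open>Comparison with the chain on a grid\<close>

primrec grid_buffer ::
    "(real \<Rightarrow> nat) \<Rightarrow> (real \<Rightarrow> nat) \<Rightarrow> real \<Rightarrow> (real \<Rightarrow> bool) \<Rightarrow> real \<Rightarrow> nat \<Rightarrow> real" where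
  "grid_buffer n m D P h 0 = D"
| "grid_buffer n m D P h (Suc k) = (let y = grid_buffer n m D P h k in
     y - h + real (n (real (Suc k) * h) - n (real k * h))
       + of_bool (P y) * real (m (real (Suc k) * h) - m (real k * h)))"

text \<open>
  Just before a jump the buffer decreases to its left limit, so there \<open>P\<close> already has the value that
  governs the jump; the hypothesis on \<open>P\<close> is right continuity.
\<close>

lemma grid_buffer_eq_buffer:
  assumes n: "counting_path n" and m: "counting_path m"
    and w: "buffer_solution n m D P w"
    and P: "\<And>y. \<exists>e>0. \<forall>z. y \<le> z \<longrightarrow> z < y + e \<longrightarrow> P z = P y"
  shows "\<exists>\<delta>>0. \<forall>h k. 0 < h \<longrightarrow> h < \<delta> \<longrightarrow> real k * h \<le> t \<longrightarrow>
           grid_buffer n m D P h k = buffer n m D w (real k * h)"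
proof -
  define J where "J = jump_times m t"
  have finJ: "finite J" unfolding J_def by (rule finite_jump_times[OF m])
  \<comment> \<open>Each of the finitely many jumps gets a window before it in which
    \<open>P\<close> of the buffer has the value that governs the jump.\<close>
  have "\<forall>\<tau>\<in>J. \<exists>e>0. \<forall>s. 0 \<le> s \<longrightarrow> \<tau> - e < s \<longrightarrow> s < \<tau> \<longrightarrow>
      P (buffer n m D w s) = P (buffer_left n m D w \<tau>)"
  proof
    fix \<tau> assume "\<tau> \<in> J"
    hence "0 < \<tau>" by (simp add: J_def jump_times_def)
    then obtain a where a: "0 \<le> a" "a < \<tau>"
        "\<And>s. a \<le> s \<Longrightarrow> s < \<tau> \<Longrightarrow> buffer n m D w s = buffer_left n m D w \<tau> + (\<tau> - s)"
      using buffer_at_left[OF n m] by blast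
    obtain e where e: "e > 0" "\<And>z. buffer_left n m D w \<tau> \<le> z \<Longrightarrow> z < buffer_left n m D w \<tau> + e \<Longrightarrow>
        P z = P (buffer_left n m D w \<tau>)" using P by blast
    show "\<exists>e>0. \<forall>s. 0 \<le> s \<longrightarrow> \<tau> - e < s \<longrightarrow> s < \<tau> \<longrightarrow>
      P (buffer n m D w s) = P (buffer_left n m D w \<tau>)"
    proof (intro exI[of _ "min e (\<tau> - a)"] conjI allI impI)
      fix s assume "0 \<le> s" "\<tau> - min e (\<tau> - a) < s" "s < \<tau>"
      thus "P (buffer n m D w s) = P (buffer_left n m D w \<tau>)"
        using a(3)[of s] e(2)[of "buffer n m D w s"] by simp
    qed (use a e(1) in simp)
  qed
  from bchoice[OF this] obtain e where e: "\<And>\<tau>. \<tau> \<in> J \<Longrightarrow> e \<tau> > 0"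
      "\<And>\<tau> s. \<tau> \<in> J \<Longrightarrow> 0 \<le> s \<Longrightarrow> \<tau> - e \<tau> < s \<Longrightarrow> s < \<tau> \<Longrightarrow>
         P (buffer n m D w s) = P (buffer_left n m D w \<tau>)"
    by blast
  \<comment> \<open>The mesh must be shorter than every window; inserting 1 keeps the minimum
    defined when there are no jumps.\<close>
  define \<delta> where "\<delta> = Min (insert 1 (e ` J))"
  have d: "\<delta> > 0" "\<And>\<tau>. \<tau> \<in> J \<Longrightarrow> \<delta> \<le> e \<tau>"
    using finJ e(1) by (auto simp: \<delta>_def)
  have "grid_buffer n m D P h k = buffer n m D w (real k * h)"
    if h: "0 < h" "h < \<delta>" and "real k * h \<le> t" for h k
    using \<open>real k * h \<le> t\<close>
  proof (induction k)
    case 0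
    have "jump_times m 0 = {}" by (auto simp: jump_times_def)
    moreover have "n 0 = 0" using n by (simp add: counting_path_def)
    ultimately show ?case by (simp add: buffer_def)
  next
    case (Suc k)
    define s r where "s = real k * h" and "r = real (Suc k) * h"
    have sr: "0 \<le> s" "s \<le> r" "r = s + h" using h by (auto simp: s_def r_def algebra_simps)
    have rt: "r \<le> t" using Suc.prems by (simp add: r_def)
    have IH: "grid_buffer n m D P h k = buffer n m D w s"
      using Suc.IH Suc.prems h sr rt by (simp add: s_def)
    have split: "jump_times m r = jump_times m s \<union> jump_times m r \<inter> {s<..}"
      using sr by (auto simp: jump_times_def)
    have "(\<Sum>\<tau>\<in>jump_times m r. w \<tau>)
        = (\<Sum>\<tau>\<in>jump_times m s. w \<tau>) + (\<Sum>\<tau>\<in>jump_times m r \<inter> {s<..}. w \<tau>)"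
      by (subst split, intro sum.union_disjoint finite_Int finite_jump_times[OF m] disjI1)
        (auto simp: jump_times_def)
    \<comment> \<open>Every jump in \<open>(s, r]\<close> has \<open>s\<close> in its window, so all
      of them, however many, are governed by the action chosen at the grid point
      \<open>s\<close>.\<close>
    also have "(\<Sum>\<tau>\<in>jump_times m r \<inter> {s<..}. w \<tau>)
        = (\<Sum>\<tau>\<in>jump_times m r \<inter> {s<..}. of_bool (P (buffer n m D w s)) * jump_size m \<tau>)"
    proof (rule sum.cong[OF refl])
      fix \<tau> assume \<tau>: "\<tau> \<in> jump_times m r \<inter> {s<..}"
      hence J: "\<tau> \<in> J" using rt by (auto simp: J_def jump_times_def)
      have "\<tau> - e \<tau> < s" using \<tau> d(2)[OF J] h sr by (auto simp: jump_times_def)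
      hence "P (buffer n m D w s) = P (buffer_left n m D w \<tau>)" using e(2)[OF J sr(1)] \<tau> by simp
      thus "w \<tau> = of_bool (P (buffer n m D w s)) * jump_size m \<tau>"
        using w \<tau> unfolding buffer_solution_def by auto
    qed
    also have "\<dots> = of_bool (P (buffer n m D w s)) * (m r - m s)"
    proof -
      have "(\<Sum>\<tau>\<in>jump_times m r \<inter> {s<..}. jump_size m \<tau>) = m r - m s"
        using sum_jump_size[OF m sr(1,2)] by linarith
      thus ?thesis by (simp add: sum_distrib_left[symmetric])
    qed
    finally have "real (\<Sum>\<tau>\<in>jump_times m r. w \<tau>) = real (\<Sum>\<tau>\<in>jump_times m s. w \<tau>)
        + of_bool (P (buffer n m D w s)) * real (m r - m s)" by simp
    moreover have "real (n r) = real (n s) + real (n r - n s)"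
      using counting_path_mono[OF n sr(1,2)] by simp
    ultimately have "buffer n m D w r = buffer n m D w s - h + real (n r - n s)
        + of_bool (P (buffer n m D w s)) * real (m r - m s)"
      unfolding buffer_def using sr(3) by argo
    thus ?case unfolding grid_buffer.simps Let_def IH s_def[symmetric] r_def[symmetric] by (rule sym)
  qed
  thus ?thesis using d(1) by blast
qed

section \<open>The threshold policy in terms of buffer solutions\<close>

lemma threshold_at_right:
  obtains e where "e > 0"
    "\<And>z. y < z \<Longrightarrow> z < y + e \<Longrightarrow> (0 < z \<and> ereal z < T) = (0 \<le> y \<and> ereal y < T)"
    "\<And>z. y \<le> z \<Longrightarrow> z < y + e \<Longrightarrow> (ereal z < T) = (ereal y < T)"
proof (cases T)
  case (real r)
  \<comment> \<open>The radius is the smaller of the distances from \<open>y\<close> up to the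
    switching points 0 and \<open>r\<close>, with 1 in place of a point that is not above
    \<open>y\<close>.\<close>
  show thesis
    by (rule that[of "min (if y < 0 then - y else 1) (if y < r then r - y else 1)"])
      (auto simp: real split: if_splits)
next
  case PInf
  show thesis
    by (rule that[of "if y < 0 then - y else 1"]) (auto simp: PInf split: if_splits)
next
  case MInf
  show thesis by (rule that[of 1]) (auto simp: MInf)
qed

text \<open>The buffer stays strictly above its left limit just before \<open>\<tau>\<close>, so the
  test \<open>0 < x t\<close> becomes \<open>0 \<le>\<close> at the limit, while the strict upper
  test is preserved.\<close>

lemma Lim_threshold_action:
  assumes n: "counting_path n" and m: "counting_path m" and "0 < \<tau>"
    and u: "\<And>t. 0 \<le> t \<Longrightarrow> u t = (if 0 < x t \<and> ereal (x t) < T then 1 else 0)"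
    and x: "\<And>t. 0 \<le> t \<Longrightarrow> x t = buffer n m D w t"
  shows "Lim (at_left \<tau>) u
    = (of_bool (0 \<le> buffer_left n m D w \<tau> \<and> ereal (buffer_left n m D w \<tau>) < T) :: nat)"
proof (rule Lim_at_left_eq)
  let ?y = "buffer_left n m D w \<tau>"
  obtain a where a: "0 \<le> a" "a < \<tau>"
      "\<And>s. a \<le> s \<Longrightarrow> s < \<tau> \<Longrightarrow> buffer n m D w s = ?y + (\<tau> - s)"
    using buffer_at_left[OF n m \<open>0 < \<tau>\<close>] by blast
  obtain e where e: "e > 0"
    "\<And>z. ?y < z \<Longrightarrow> z < ?y + e \<Longrightarrow> (0 < z \<and> ereal z < T) = (0 \<le> ?y \<and> ereal ?y < T)"
    using threshold_at_right[of ?y T] by metis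
  have "u s = of_bool (0 \<le> ?y \<and> ereal ?y < T)" if "max a (\<tau> - e) < s" "s < \<tau>" for s
    using a(1) a(3)[of s] u[of s] x[of s] e(2)[of "?y + (\<tau> - s)"] that by auto
  moreover have "max a (\<tau> - e) < \<tau>" using a(2) e(1) by simp
  ultimately show "eventually (\<lambda>s. u s = of_bool (0 \<le> ?y \<and> ereal ?y < T)) (at_left \<tau>)"
    unfolding eventually_at_left_field by blast
qed

text \<open>Together with the converse \<open>buffer_controlled_path\<close>, this replaces the
  coupled equations for buffer and action by one condition on the weights at jump times.\<close>

lemma controlled_path_buffer:
  assumes n: "counting_path n" and m: "counting_path m"
    and u: "\<And>t. 0 \<le> t \<Longrightarrow> u t = (if 0 < x t \<and> ereal (x t) < T then 1 else 0)"
    and x: "\<And>t. 0 \<le> t \<Longrightarrow> x t = D + real (n t) + real (action_integral u m t) - t"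
  obtains w where "buffer_solution n m D (\<lambda>y. 0 \<le> y \<and> ereal y < T) w"
    "\<And>t. 0 \<le> t \<Longrightarrow> x t = buffer n m D w t"
proof
  let ?w = "\<lambda>\<tau>. Lim (at_left \<tau>) u * jump_size m \<tau>"
  show x': "x t = buffer n m D ?w t" if "0 \<le> t" for t
    using x[OF that] by (simp add: buffer_def action_integral_def jump_times_def jump_size_def)
  show "buffer_solution n m D (\<lambda>y. 0 \<le> y \<and> ereal y < T) ?w"
    unfolding buffer_solution_def
  proof (intro allI ballI)
    fix t \<tau> assume "\<tau> \<in> jump_times m t"
    hence "0 < \<tau>" by (simp add: jump_times_def)
    from Lim_threshold_action[OF n m this u x']
    show "?w \<tau> = of_bool (0 \<le> buffer_left n m D ?w \<tau> \<and> ereal (buffer_left n m D ?w \<tau>) < T)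
        * jump_size m \<tau>" by simp
  qed
qed

lemma buffer_controlled_path:
  assumes n: "counting_path n" and m: "counting_path m"
    and w: "buffer_solution n m D (\<lambda>y. 0 \<le> y \<and> ereal y < T) w"
    and u: "u = (\<lambda>t. if 0 < buffer n m D w t \<and> ereal (buffer n m D w t) < T then 1 else 0)"
  shows "buffer n m D w t = D + real (n t) + real (action_integral u m t) - t"
proof -
  have "action_integral u m t = (\<Sum>\<tau>\<in>jump_times m t. Lim (at_left \<tau>) u * jump_size m \<tau>)"
    by (simp add: action_integral_def jump_times_def jump_size_def)
  also have "\<dots> = (\<Sum>\<tau>\<in>jump_times m t. w \<tau>)"
  proof (rule sum.cong[OF refl])
    fix \<tau> assume \<tau>: "\<tau> \<in> jump_times m t"
    hence "0 < \<tau>" by (simp add: jump_times_def)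
    hence "Lim (at_left \<tau>) u
      = of_bool (0 \<le> buffer_left n m D w \<tau> \<and> ereal (buffer_left n m D w \<tau>) < T)"
      by (rule Lim_threshold_action[OF n m, where x = "buffer n m D w"]) (simp_all add: u)
    thus "Lim (at_left \<tau>) u * jump_size m \<tau> = w \<tau>"
      using w \<tau> unfolding buffer_solution_def by simp
  qed
  finally show ?thesis by (simp add: buffer_def)
qed

section \<open>Dyadic times and the interruption event\<close>

lemma eventually_grid_buffer:
  assumes n: "counting_path n" and m: "counting_path m"
    and w: "buffer_solution n m D (\<lambda>y. ereal y < T) w"
  shows "eventually (\<lambda>k. grid_buffer n m D (\<lambda>y. ereal y < T) (1 / 2 ^ k) (j * 2 ^ (k - i))
           = buffer n m D w (real j / 2 ^ i)) sequentially"
proof -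
  have P: "\<exists>e>0. \<forall>z. y \<le> z \<longrightarrow> z < y + e \<longrightarrow> (ereal z < T) = (ereal y < T)" for y
    using threshold_at_right[of y T] by metis
  obtain \<delta> where \<delta>: "\<delta> > 0" "\<And>h k. 0 < h \<Longrightarrow> h < \<delta> \<Longrightarrow> real k * h \<le> real j / 2 ^ i \<Longrightarrow>
      grid_buffer n m D (\<lambda>y. ereal y < T) h k = buffer n m D w (real k * h)"
    using grid_buffer_eq_buffer[OF n m w P, of "real j / 2 ^ i"] by blast
  have "(\<lambda>k. (1 / 2) ^ k) \<longlonglongrightarrow> (0 :: real)" by (rule LIMSEQ_power_zero) simp
  hence "eventually (\<lambda>k. (1 / 2) ^ k < \<delta>) sequentially"
    using \<delta>(1) by (rule order_tendstoD)
  thus ?thesis using eventually_ge_at_top[of i]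
  proof eventually_elim
    case (elim k)
    \<comment> \<open>A dyadic time remains a grid point at every finer level;
      \<open>i \<le> k\<close> makes the truncated subtraction exact.\<close>
    have "real (j * 2 ^ (k - i)) * (1 / 2 ^ k) = real j / 2 ^ i"
      using le_Suc_ex[OF elim(2)] by (auto simp: power_add)
    thus ?case using \<delta>(2)[of "1 / 2 ^ k" "j * 2 ^ (k - i)"] elim(1)
      by (simp add: power_one_over)
  qed
qed

lemma dyadic_between:
  fixes s t :: real
  assumes "0 \<le> s" "s < t"
  obtains i j :: nat where "s < real j / 2 ^ i" "real j / 2 ^ i < t"
proof -
  obtain i where i: "(1 / 2 :: real) ^ i < t - s"
    using real_arch_pow_inv[of "t - s" "1 / 2"] assms by auto
  define j where "j = nat \<lfloor>s * 2 ^ i\<rfloor> + 1"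
  have j: "real j = of_int \<lfloor>s * 2 ^ i\<rfloor> + 1"
    using assms(1) by (simp add: j_def)
  have "s * 2 ^ i < real j" "real j \<le> s * 2 ^ i + 1"
    unfolding j by linarith+
  moreover from this have "real j < t * 2 ^ i"
    using i by (simp add: power_one_over field_simps)
  ultimately show thesis
    using that[of j i] by (simp add: field_simps)
qed

text \<open>After reaching zero the buffer keeps draining for a while, so it is strictly negative at
  some dyadic time. At a fixed dyadic time the chain eventually equals the buffer, so the converse
  is immediate.\<close>

lemma buffer_interruption_iff_grid:
  assumes n: "counting_path n" and m: "counting_path m"
    and w: "buffer_solution n m D (\<lambda>y. ereal y < T) w"
  shows "(\<exists>t\<ge>0. buffer n m D w t \<le> 0) \<longleftrightarrow>
    (\<exists>i j. eventually (\<lambda>k. grid_buffer n m D (\<lambda>y. ereal y < T) (1 / 2 ^ k) (j * 2 ^ (k - i)) < 0)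
       sequentially)"
proof
  assume "\<exists>t\<ge>0. buffer n m D w t \<le> 0"
  then obtain t where t: "0 \<le> t" "buffer n m D w t \<le> 0" by blast
  obtain b where b: "t < b"
      "\<And>s. t \<le> s \<Longrightarrow> s < b \<Longrightarrow> buffer n m D w s = buffer n m D w t - (s - t)"
    using buffer_at_right[OF n m t(1)] by blast
  obtain i j :: nat where ij: "t < real j / 2 ^ i" "real j / 2 ^ i < b"
    using dyadic_between[OF t(1) b(1)] by blast
  hence "buffer n m D w (real j / 2 ^ i) < 0" using b(2)[of "real j / 2 ^ i"] t(2) by linarith
  with eventually_grid_buffer[OF n m w, of j i] show "\<exists>i j. eventually (\<lambda>k.
      grid_buffer n m D (\<lambda>y. ereal y < T) (1 / 2 ^ k) (j * 2 ^ (k - i)) < 0) sequentially"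
    by (intro exI[of _ i] exI[of _ j]) (auto elim: eventually_mono)
next
  assume "\<exists>i j. eventually (\<lambda>k.
      grid_buffer n m D (\<lambda>y. ereal y < T) (1 / 2 ^ k) (j * 2 ^ (k - i)) < 0) sequentially"
  then obtain i j where "eventually (\<lambda>k.
      grid_buffer n m D (\<lambda>y. ereal y < T) (1 / 2 ^ k) (j * 2 ^ (k - i)) < 0) sequentially" by blast
  hence "eventually (\<lambda>k. buffer n m D w (real j / 2 ^ i) < 0) sequentially"
    using eventually_grid_buffer[OF n m w, of j i] by eventually_elim simp
  hence "buffer n m D w (real j / 2 ^ i) < 0" by (simp add: eventually_const)
  thus "\<exists>t\<ge>0. buffer n m D w t \<le> 0"
    by (intro exI[of _ "real j / 2 ^ i"]) simp
qed

text \<open>If one path stayed positive, \<open>buffer_solution_transfer\<close> would make both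
  paths equal. One implication suffices, with the roles exchanged for the other.\<close>

lemma buffer_interruption_cong:
  assumes n: "counting_path n" and m: "counting_path m"
    and w: "buffer_solution n m D P w" and w': "buffer_solution n m D P' w'"
    and P: "\<And>y. 0 \<le> y \<Longrightarrow> P y \<longleftrightarrow> P' y"
  shows "(\<exists>t\<ge>0. buffer n m D w t \<le> 0) \<longleftrightarrow> (\<exists>t\<ge>0. buffer n m D w' t \<le> 0)"
proof -
  have "\<exists>t\<ge>0. buffer n m D w' t \<le> 0"
    if "buffer_solution n m D P w" "buffer_solution n m D P' w'" "\<And>y. 0 \<le> y \<Longrightarrow> P y \<longleftrightarrow> P' y"
      "\<exists>t\<ge>0. buffer n m D w t \<le> 0" for P P' w w'
  proof (rule ccontr)
    assume "\<not> ?thesis"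
    hence pos: "\<And>t. 0 \<le> t \<Longrightarrow> 0 < buffer n m D w' t" by force
    have "buffer n m D w' t = buffer n m D w t" for t
      using that(3) by (intro buffer_solution_transfer[OF n m that(2,1) _ pos]) auto
    thus False using pos that(4) by (metis not_le)
  qed
  from this[OF w w' P] this[OF w' w P[symmetric]] show ?thesis by blast
qed

section \<open>Independence and supermartingale chains\<close>

context prob_space
begin

lemma indep_var_prob_inter:
  assumes "indep_var S X T Y" "a \<in> sets S" "b \<in> sets T"
  shows "prob ((X -` a \<inter> space M) \<inter> (Y -` b \<inter> space M))
    = prob (X -` a \<inter> space M) * prob (Y -` b \<inter> space M)"
  using assms indep_varD[OF assms] by (auto simp: vimage_def Int_def conj_ac intro!: arg_cong[where f=prob])

text \<open>Rectangles form an intersection-stable generator of the product, so factorization is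
  checked on them only. There \<open>AB\<close> separates the two families, independence within each
  splits the factors, and \<open>AB\<close> for single indices regroups them into pairs.\<close>

lemma indep_vars_Pair:
  assumes I: "finite I" "I \<noteq> {}"
    and A: "indep_vars S A I" and B: "indep_vars T B I"
    and AB: "indep_var (PiM I S) (\<lambda>\<omega>. \<lambda>i\<in>I. A i \<omega>) (PiM I T) (\<lambda>\<omega>. \<lambda>i\<in>I. B i \<omega>)"
  shows "indep_vars (\<lambda>i. S i \<Otimes>\<^sub>M T i) (\<lambda>i \<omega>. (A i \<omega>, B i \<omega>)) I"
proof -
  let ?E = "\<lambda>i. {a \<times> b | a b. a \<in> sets (S i) \<and> b \<in> sets (T i)}"
  have rvA: "random_variable (S i) (A i)" and rvB: "random_variable (T i) (B i)" if "i \<in> I" for i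
    using A B that unfolding indep_vars_def by auto
  have "indep_vars (\<lambda>i. S i \<Otimes>\<^sub>M T i) (\<lambda>i \<omega>. (A i \<omega>, B i \<omega>)) I \<longleftrightarrow>
    (\<forall>C\<in>(\<Pi> i\<in>I. ?E i). prob (\<Inter>j\<in>I. (\<lambda>\<omega>. (A j \<omega>, B j \<omega>)) -` C j \<inter> space M)
       = (\<Prod>j\<in>I. prob ((\<lambda>\<omega>. (A j \<omega>, B j \<omega>)) -` C j \<inter> space M)))"
  proof (rule indep_vars_finite)
    show "sets (S i \<Otimes>\<^sub>M T i) = sigma_sets (space (S i \<Otimes>\<^sub>M T i)) (?E i)" if "i \<in> I" for i
      by (simp add: sets_pair_measure space_pair_measure)
    show "random_variable (S i \<Otimes>\<^sub>M T i) (\<lambda>\<omega>. (A i \<omega>, B i \<omega>))" if "i \<in> I" for i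
      using rvA[OF that] rvB[OF that] by measurable
    show "Int_stable (?E i)" if "i \<in> I" for i by (rule Int_stable_pair_measure_generator)
    show "space (S i \<Otimes>\<^sub>M T i) \<in> ?E i" if "i \<in> I" for i by (auto simp: space_pair_measure)
    show "?E i \<subseteq> Pow (space (S i \<Otimes>\<^sub>M T i))" if "i \<in> I" for i
      using pair_measure_closed by (simp add: space_pair_measure)
  qed (use I in auto)
  moreover have "prob (\<Inter>j\<in>I. (\<lambda>\<omega>. (A j \<omega>, B j \<omega>)) -` C j \<inter> space M)
       = (\<Prod>j\<in>I. prob ((\<lambda>\<omega>. (A j \<omega>, B j \<omega>)) -` C j \<inter> space M))"
    if "C \<in> (\<Pi> i\<in>I. ?E i)" for C
  proof -
    have "\<forall>i\<in>I. \<exists>ab. C i = fst ab \<times> snd ab \<and> fst ab \<in> sets (S i) \<and> snd ab \<in> sets (T i)"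
    proof
      fix i assume "i \<in> I"
      with that have "C i \<in> ?E i" by (rule Pi_mem)
      thus "\<exists>ab. C i = fst ab \<times> snd ab \<and> fst ab \<in> sets (S i) \<and> snd ab \<in> sets (T i)" by force
    qed
    from bchoice[OF this] obtain ab where ab: "\<And>i. i \<in> I \<Longrightarrow> C i = fst (ab i) \<times> snd (ab i)"
      "\<And>i. i \<in> I \<Longrightarrow> fst (ab i) \<in> sets (S i)" "\<And>i. i \<in> I \<Longrightarrow> snd (ab i) \<in> sets (T i)" by blast
    define a b where "a = fst \<circ> ab" and "b = snd \<circ> ab"
    note ab = ab[folded comp_apply[of fst ab, folded a_def] comp_apply[of snd ab, folded b_def]]
    have indep: "prob (\<Inter>j\<in>I. X j -` c j \<inter> space M) = (\<Prod>j\<in>I. prob (X j -` c j \<inter> space M))"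
      if "indep_vars Q X I" "\<And>j. j \<in> I \<Longrightarrow> c j \<in> sets (Q j)" for Q c
        and X :: "_ \<Rightarrow> 'a \<Rightarrow> 'z"
      using that I unfolding indep_vars_def2 by (intro indep_setsD[where I=I]) auto
    have vim: "(\<lambda>\<omega>. \<lambda>i\<in>I. X i \<omega>) -` (Pi\<^sub>E I c) \<inter> space M = (\<Inter>j\<in>I. X j -` c j \<inter> space M)"
      for X :: "_ \<Rightarrow> 'a \<Rightarrow> 'z" and c
      using I by (auto simp: PiE_iff)
    have Pair: "prob ((\<lambda>\<omega>. (A j \<omega>, B j \<omega>)) -` C j \<inter> space M)
        = prob (A j -` a j \<inter> space M) * prob (B j -` b j \<inter> space M)" if "j \<in> I" for j
    proof -
      have "indep_var (S j) ((\<lambda>f. f j) \<circ> (\<lambda>\<omega>. \<lambda>i\<in>I. A i \<omega>)) (T j) ((\<lambda>f. f j) \<circ> (\<lambda>\<omega>. \<lambda>i\<in>I. B i \<omega>))"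
        using that by (intro indep_var_compose[OF AB] measurable_component_singleton)
      hence "indep_var (S j) (A j) (T j) (B j)" using that by (simp add: comp_def)
      from indep_var_prob_inter[OF this ab(2,3)[OF that]]
      show ?thesis using ab(1)[OF that] by (simp add: vimage_def Int_def conj_ac mem_Times_iff)
    qed
    have "(\<Inter>j\<in>I. (\<lambda>\<omega>. (A j \<omega>, B j \<omega>)) -` C j \<inter> space M)
       = (\<Inter>j\<in>I. A j -` a j \<inter> space M) \<inter> (\<Inter>j\<in>I. B j -` b j \<inter> space M)"
      using ab(1) I by auto
    also have "prob \<dots> = prob (\<Inter>j\<in>I. A j -` a j \<inter> space M) * prob (\<Inter>j\<in>I. B j -` b j \<inter> space M)"
      using indep_var_prob_inter[OF AB, of "Pi\<^sub>E I a" "Pi\<^sub>E I b"] ab(2,3) I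
      by (simp add: vim sets_PiM_I_finite)
    also have "\<dots> = (\<Prod>j\<in>I. prob (A j -` a j \<inter> space M) * prob (B j -` b j \<inter> space M))"
      using indep[OF A ab(2)] indep[OF B ab(3)] by (simp add: prod.distrib)
    also have "\<dots> = (\<Prod>j\<in>I. prob ((\<lambda>\<omega>. (A j \<omega>, B j \<omega>)) -` C j \<inter> space M))"
      using Pair by (intro prod.cong) simp_all
    finally show ?thesis .
  qed
  ultimately show ?thesis by blast
qed

text \<open>Independence makes the joint law the product of the marginals, to which Tonelli
  applies.\<close>

lemma nn_integral_indep_var:
  assumes XY: "indep_var S X T Y" and f: "f \<in> borel_measurable (S \<Otimes>\<^sub>M T)"
  shows "(\<integral>\<^sup>+\<omega>. f (X \<omega>, Y \<omega>) \<partial>M) = (\<integral>\<^sup>+x. \<integral>\<^sup>+y. f (x, y) \<partial>distr M T Y \<partial>distr M S X)"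
proof -
  have rv: "random_variable S X" "random_variable T Y"
    and eq: "distr M S X \<Otimes>\<^sub>M distr M T Y = distr M (S \<Otimes>\<^sub>M T) (\<lambda>x. (X x, Y x))"
    using XY unfolding indep_var_distribution_eq by auto
  interpret Y: prob_space "distr M T Y" by (rule prob_space_distr) (rule rv)
  have "(\<integral>\<^sup>+\<omega>. f (X \<omega>, Y \<omega>) \<partial>M) = (\<integral>\<^sup>+z. f z \<partial>distr M (S \<Otimes>\<^sub>M T) (\<lambda>x. (X x, Y x)))"
    using rv f by (subst nn_integral_distr) auto
  also have "\<dots> = (\<integral>\<^sup>+x. \<integral>\<^sup>+y. f (x, y) \<partial>distr M T Y \<partial>distr M S X)"
    unfolding eq[symmetric] using f by (intro Y.nn_integral_fst[symmetric]) simp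
  finally show ?thesis .
qed

text \<open>
  \<^const>\<open>indep_var\<close> only applies to two random variables with the same type of values, so the chain is
  viewed as a function of the restricted family of the \<open>X i\<close>.
\<close>

lemma nn_integral_chain_le:
  fixes X :: "nat \<Rightarrow> 'a \<Rightarrow> 'b" and z :: "nat \<Rightarrow> 'a \<Rightarrow> 'c"
  assumes X: "indep_vars (\<lambda>_. S) X {..<n}"
    and z0: "\<And>\<omega>. z 0 \<omega> = D" and zS: "\<And>k \<omega>. z (Suc k) \<omega> = s (z k \<omega>, X k \<omega>)"
    and D: "D \<in> space Q"
    and s [measurable]: "s \<in> measurable (Q \<Otimes>\<^sub>M S) Q"
    and V [measurable]: "V \<in> borel_measurable Q"
    and step: "\<And>k y. k < n \<Longrightarrow> y \<in> space Q \<Longrightarrow> (\<integral>\<^sup>+b. V (s (y, b)) \<partial>distr M S (X k)) \<le> V y"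
    and "k \<le> n"
  shows "(\<integral>\<^sup>+\<omega>. V (z k \<omega>) \<partial>M) \<le> V D"
  using \<open>k \<le> n\<close>
proof (induction k)
  case 0
  thus ?case by (simp add: z0 emeasure_space_1)
next
  case (Suc k)
  \<comment> \<open>The chain as a deterministic function of its inputs. The state
    \<open>g f k\<close> uses only the entries of \<open>f\<close> below \<open>k\<close>, which
    makes it independent of \<open>X k\<close>.\<close>
  define g where "g f = rec_nat D (\<lambda>k y. s (y, f k))" for f :: "nat \<Rightarrow> 'b"
  have g0: "g f 0 = D" and gS: "g f (Suc k) = s (g f k, f k)" for f k by (simp_all add: g_def)
  have g: "(\<lambda>f. g f k) \<in> measurable (PiM I (\<lambda>_. S)) Q" if "{..<k} \<subseteq> I" for k I
    using that
  proof (induction k)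
    case (Suc k)
    hence "(\<lambda>f. g f k) \<in> measurable (PiM I (\<lambda>_. S)) Q" "k \<in> I"
      by (auto simp: lessThan_Suc)
    thus ?case unfolding gS by (intro measurable_compose[OF _ s] measurable_Pair) auto
  qed (simp add: g0 D)
  have gz: "g (\<lambda>i\<in>{..<j}. X i \<omega>) k = z k \<omega>" if "k \<le> j" for k j \<omega>
    using that by (induction k) (simp_all add: g0 gS z0 zS)
  let ?F = "\<lambda>\<omega>. \<lambda>i\<in>{..<k}. X i \<omega>" and ?G = "\<lambda>\<omega>. \<lambda>i\<in>{k}. X i \<omega>"
  have indep: "indep_var (PiM {..<k} (\<lambda>_. S)) ?F (PiM {k} (\<lambda>_. S)) ?G"
    using Suc.prems by (intro indep_var_restrict[OF X]) auto
  hence rv: "random_variable (PiM {..<k} (\<lambda>_. S)) ?F" "random_variable (PiM {k} (\<lambda>_. S)) ?G"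
    by (simp_all add: indep_var_distribution_eq)
  have Xk [measurable]: "random_variable S (X k)"
    using X Suc.prems by (simp add: indep_vars_def)
  have [measurable]: "(\<lambda>f. g f k) \<in> measurable (PiM {..<k} (\<lambda>_. S)) Q"
    "(\<lambda>f. f k) \<in> measurable (PiM {k} (\<lambda>_. S)) S"
    by (rule g[OF order_refl]) (rule measurable_component_singleton, rule singletonI)
  have "(\<integral>\<^sup>+\<omega>. V (z (Suc k) \<omega>) \<partial>M)
      = (\<integral>\<^sup>+\<omega>. (\<lambda>(f, e). V (s (g f k, e k))) (?F \<omega>, ?G \<omega>) \<partial>M)"
    by (simp add: zS gz)
  also have "\<dots> = (\<integral>\<^sup>+f. \<integral>\<^sup>+e. (\<lambda>(f, e). V (s (g f k, e k))) (f, e)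
      \<partial>distr M (PiM {k} (\<lambda>_. S)) ?G \<partial>distr M (PiM {..<k} (\<lambda>_. S)) ?F)"
    by (intro nn_integral_indep_var[OF indep]) measurable
  \<comment> \<open>With the past fixed, the inner integral is one step of the chain from the state
    \<open>g f k\<close>.\<close>
  also have "\<dots> \<le> (\<integral>\<^sup>+f. V (g f k) \<partial>distr M (PiM {..<k} (\<lambda>_. S)) ?F)"
  proof (rule nn_integral_mono)
    fix f assume "f \<in> space (distr M (PiM {..<k} (\<lambda>_. S)) ?F)"
    hence gf: "g f k \<in> space Q" using measurable_space[OF g[OF order_refl]] by simp
    hence "(\<lambda>b. s (g f k, b)) \<in> measurable S Q" by (intro measurable_Pair2[OF s])
    hence Vs: "(\<lambda>b. V (s (g f k, b))) \<in> borel_measurable S" by (rule measurable_compose[OF _ V])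
    have "(\<integral>\<^sup>+e. V (s (g f k, e k)) \<partial>distr M (PiM {k} (\<lambda>_. S)) ?G)
        = (\<integral>\<^sup>+\<omega>. V (s (g f k, X k \<omega>)) \<partial>M)"
      using Vs by (subst nn_integral_distr[OF rv(2)]) simp_all
    also have "\<dots> = (\<integral>\<^sup>+b. V (s (g f k, b)) \<partial>distr M S (X k))"
      using Vs by (intro nn_integral_distr[symmetric] Xk) simp
    also have "\<dots> \<le> V (g f k)" using step[OF _ gf, of k] Suc.prems by simp
    finally show "(\<integral>\<^sup>+e. (\<lambda>(f, e). V (s (g f k, e k))) (f, e) \<partial>distr M (PiM {k} (\<lambda>_. S)) ?G)
        \<le> V (g f k)" by simp
  qed
  also have "\<dots> = (\<integral>\<^sup>+\<omega>. V (z k \<omega>) \<partial>M)"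
    by (subst nn_integral_distr[OF rv(1)]) (simp_all add: gz)
  also have "\<dots> \<le> V D" using Suc by simp
  finally show ?case .
qed

end

text \<open>The factor \<open>exp (- a) ^ k\<close> merges with the power in the Poisson weights,
  leaving the exponential series at \<open>r * exp (- a)\<close>.\<close>

lemma nn_integral_exp_poisson:
  assumes "0 < r"
  shows "(\<integral>\<^sup>+k. ennreal (exp (- a * real k)) \<partial>measure_pmf (poisson_pmf r))
    = ennreal (exp (r * (exp (- a) - 1)))"
proof -
  have s: "(\<lambda>k. exp (- r) * ((r * exp (- a)) ^ k /\<^sub>R fact k)) sums (exp (- r) * exp (r * exp (- a)))"
    by (intro sums_mult exp_converges)
  have "(\<integral>\<^sup>+k. ennreal (exp (- a * real k)) \<partial>measure_pmf (poisson_pmf r))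
      = (\<integral>\<^sup>+k. ennreal (exp (- r) * ((r * exp (- a)) ^ k /\<^sub>R fact k)) \<partial>count_space UNIV)"
    unfolding nn_integral_measure_pmf
  proof (intro nn_integral_cong)
    fix k
    have "exp (- (a * real k)) = exp (- a) ^ k"
      by (simp add: exp_of_nat_mult[symmetric] mult.commute)
    thus "ennreal (pmf (poisson_pmf r) k) * ennreal (exp (- a * real k))
        = ennreal (exp (- r) * ((r * exp (- a)) ^ k /\<^sub>R fact k))"
      using assms
      by (simp add: pmf_poisson[OF assms] ennreal_mult[symmetric] power_mult_distrib field_simps)
  qed
  also have "\<dots> = ennreal (exp (- r) * exp (r * exp (- a)))"
    unfolding nn_integral_count_space_nat using s assms by (intro suminf_ennreal_eq) auto
  also have "exp (- r) * exp (r * exp (- a)) = exp (r * (exp (- a) - 1))"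
    by (simp add: exp_add[symmetric] algebra_simps)
  finally show ?thesis .
qed

section \<open>The interruption bound\<close>

lemma borel_measurable_grid_buffer:
  assumes "0 \<le> h" "\<And>t. 0 \<le> t \<Longrightarrow> N t \<in> measurable M (count_space UNIV)"
    "\<And>t. 0 \<le> t \<Longrightarrow> Nc t \<in> measurable M (count_space UNIV)"
    and P [measurable]: "Measurable.pred borel P"
  shows "(\<lambda>\<omega>. grid_buffer (\<lambda>t. N t \<omega>) (\<lambda>t. Nc t \<omega>) D P h k) \<in> borel_measurable M"
proof (induction k)
  case (Suc k)
  note Suc [measurable]
  have [measurable]: "N (real i * h) \<in> measurable M (count_space UNIV)"
    "Nc (real i * h) \<in> measurable M (count_space UNIV)" for i
    using assms by simp_all
  show ?case unfolding grid_buffer.simps Let_def of_bool_def by measurable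
qed simp

section \<open>Grid increments of the two processes\<close>

lemma poisson_process_increments:
  assumes N: "poisson_process M R N" and h: "0 < h"
  shows "prob_space.indep_vars M (\<lambda>_. count_space UNIV)
      (\<lambda>i \<omega>. N (real (Suc i) * h) \<omega> - N (real i * h) \<omega>) {..<n}"
    and "distr M (count_space UNIV) (\<lambda>\<omega>. N (real (Suc i) * h) \<omega> - N (real i * h) \<omega>)
      = measure_pmf (poisson_pmf (R * h))"
proof -
  have "\<forall>n (t :: nat \<Rightarrow> real). 0 \<le> t 0 \<longrightarrow> (\<forall>i<n. t i \<le> t (Suc i)) \<longrightarrow>
      prob_space.indep_vars M (\<lambda>_. count_space UNIV) (\<lambda>i \<omega>. N (t (Suc i)) \<omega> - N (t i) \<omega>) {..<n}"
    using N unfolding poisson_process_def by blast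
  from this[rule_format, of "\<lambda>i. real i * h" n]
  show "prob_space.indep_vars M (\<lambda>_. count_space UNIV)
      (\<lambda>i \<omega>. N (real (Suc i) * h) \<omega> - N (real i * h) \<omega>) {..<n}"
    using h by simp
  have "\<forall>s t. 0 \<le> s \<longrightarrow> s < t \<longrightarrow> distr M (count_space UNIV) (\<lambda>\<omega>. N t \<omega> - N s \<omega>)
      = measure_pmf (poisson_pmf (R * (t - s)))"
    using N unfolding poisson_process_def by blast
  moreover have "0 \<le> real i * h" "real i * h < real (Suc i) * h" "real (Suc i) * h - real i * h = h"
    using h by (simp_all add: algebra_simps)
  ultimately show "distr M (count_space UNIV) (\<lambda>\<omega>. N (real (Suc i) * h) \<omega> - N (real i * h) \<omega>)
      = measure_pmf (poisson_pmf (R * h))" by metis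
qed

lemma poisson_increments_indep_Pair:
  assumes "prob_space M" "poisson_process M R0 N" "poisson_process M Rc Nc"
    "indep_processes M N Nc" "0 < h" "0 < n"
  defines "A \<equiv> \<lambda>i \<omega>. N (real (Suc i) * h) \<omega> - N (real i * h) \<omega>"
    and "B \<equiv> \<lambda>i \<omega>. Nc (real (Suc i) * h) \<omega> - Nc (real i * h) \<omega>"
  shows "prob_space.indep_vars M (\<lambda>_. count_space UNIV \<Otimes>\<^sub>M count_space UNIV)
      (\<lambda>i \<omega>. (A i \<omega>, B i \<omega>)) {..<n}" (is ?thesis1)
    and "i < n \<Longrightarrow> distr M (count_space UNIV \<Otimes>\<^sub>M count_space UNIV) (\<lambda>\<omega>. (A i \<omega>, B i \<omega>))
      = measure_pmf (poisson_pmf (R0 * h)) \<Otimes>\<^sub>M measure_pmf (poisson_pmf (Rc * h))" (is "_ \<Longrightarrow> ?thesis2")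
proof -
  interpret prob_space M by fact
  let ?C = "\<lambda>_. count_space UNIV :: nat measure"
  have A: "indep_vars ?C A {..<n}" and B: "indep_vars ?C B {..<n}"
    unfolding A_def B_def
    using poisson_process_increments(1)[OF assms(2) \<open>0 < h\<close>]
      poisson_process_increments(1)[OF assms(3) \<open>0 < h\<close>] by blast+
  \<comment> \<open>The increments are a measurable image of the whole path, so independence of the
    processes carries over to them.\<close>
  let ?Y = "\<lambda>f. \<lambda>i\<in>{..<n}. f (real (Suc i) * h) - f (real i * h) :: nat"
  have Y: "?Y \<in> measurable (PiM {0..} ?C) (PiM {..<n} ?C)"
  proof (rule measurable_restrict)
    fix i
    have "(\<lambda>f. f (real j * h)) \<in> measurable (PiM {0..} ?C) (count_space UNIV)" for j
      using \<open>0 < h\<close> by (intro measurable_component_singleton) simp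
    hence "(\<lambda>f. (f (real (Suc i) * h), f (real i * h)))
        \<in> measurable (PiM {0..} ?C) (count_space UNIV \<Otimes>\<^sub>M count_space UNIV)"
      by (intro measurable_Pair)
    moreover have "(\<lambda>(a, b). a - b :: nat)
        \<in> measurable (count_space UNIV \<Otimes>\<^sub>M count_space UNIV) (count_space UNIV)"
      by (subst pair_measure_countable) auto
    ultimately show "(\<lambda>f. f (real (Suc i) * h) - f (real i * h))
        \<in> measurable (PiM {0..} ?C) (count_space UNIV)"
      using measurable_compose by fastforce
  qed
  have "?Y \<circ> (\<lambda>\<omega>. \<lambda>t\<in>{0..}. N t \<omega>) = (\<lambda>\<omega>. \<lambda>i\<in>{..<n}. A i \<omega>)"
    "?Y \<circ> (\<lambda>\<omega>. \<lambda>t\<in>{0..}. Nc t \<omega>) = (\<lambda>\<omega>. \<lambda>i\<in>{..<n}. B i \<omega>)"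
    using \<open>0 < h\<close> by (auto simp: A_def B_def fun_eq_iff)
  with indep_var_compose[OF assms(4)[unfolded indep_processes_def] Y Y]
  have AB: "indep_var (PiM {..<n} ?C) (\<lambda>\<omega>. \<lambda>i\<in>{..<n}. A i \<omega>)
      (PiM {..<n} ?C) (\<lambda>\<omega>. \<lambda>i\<in>{..<n}. B i \<omega>)" by simp
  show ?thesis1
    using \<open>0 < n\<close> by (intro indep_vars_Pair A B AB) auto
  show ?thesis2 if "i < n"
  proof -
    have "indep_var (count_space UNIV) ((\<lambda>f. f i) \<circ> (\<lambda>\<omega>. \<lambda>i\<in>{..<n}. A i \<omega>))
        (count_space UNIV) ((\<lambda>f. f i) \<circ> (\<lambda>\<omega>. \<lambda>i\<in>{..<n}. B i \<omega>))"
      using that by (intro indep_var_compose[OF AB] measurable_component_singleton) auto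
    hence "indep_var (count_space UNIV) (A i) (count_space UNIV) (B i)"
      using that by (simp add: comp_def)
    hence "distr M (count_space UNIV \<Otimes>\<^sub>M count_space UNIV) (\<lambda>\<omega>. (A i \<omega>, B i \<omega>))
        = distr M (count_space UNIV) (A i) \<Otimes>\<^sub>M distr M (count_space UNIV) (B i)"
      by (simp add: indep_var_distribution_eq)
    also have "distr M (count_space UNIV) (A i) = measure_pmf (poisson_pmf (R0 * h))"
      unfolding A_def by (rule poisson_process_increments(2)[OF assms(2) \<open>0 < h\<close>])
    also have "distr M (count_space UNIV) (B i) = measure_pmf (poisson_pmf (Rc * h))"
      unfolding B_def by (rule poisson_process_increments(2)[OF assms(3) \<open>0 < h\<close>])
    finally show ?thesis2 .
  qed
qed

text \<open>On a countable product every set is measurable, so Tonelli holds for arbitrary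
  \<open>f\<close>.\<close>

lemma nn_integral_pair_pmf_nat:
  fixes p q :: "nat pmf" and f :: "nat \<Rightarrow> nat \<Rightarrow> ennreal"
  shows "(\<integral>\<^sup>+z. f (fst z) (snd z) \<partial>(measure_pmf p \<Otimes>\<^sub>M measure_pmf q))
    = (\<integral>\<^sup>+a. \<integral>\<^sup>+b. f a b \<partial>measure_pmf q \<partial>measure_pmf p)"
proof -
  have "sets (measure_pmf p \<Otimes>\<^sub>M measure_pmf q)
      = sets (count_space (UNIV :: nat set) \<Otimes>\<^sub>M count_space (UNIV :: nat set))"
    by (intro sets_pair_measure_cong) simp_all
  also have "\<dots> = UNIV" by (subst pair_measure_countable) auto
  finally have "(\<lambda>z. f (fst z) (snd z)) \<in> borel_measurable (measure_pmf p \<Otimes>\<^sub>M measure_pmf q)"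
    by (auto simp: measurable_def space_pair_measure)
  from measure_pmf.nn_integral_fst[OF this] show ?thesis by simp
qed

text \<open>Drift and arrivals of one mesh step multiply the exponential part by a single factor. It
  equals 1 when \<open>a\<close> is a root of the equation behind \<open>rbar R\<close>: this is the
  source of the exact martingales.\<close>

lemma nn_integral_exp_step:
  assumes "0 < R" "0 < h" "0 \<le> c" "0 \<le> d"
  shows "(\<integral>\<^sup>+k. ennreal (c * exp (- a * (y - h + real k)) + d) \<partial>measure_pmf (poisson_pmf (R * h)))
    = ennreal (c * exp (- a * y) * exp (h * (a + R * (exp (- a) - 1))) + d)"
proof -
  have "(\<integral>\<^sup>+k. ennreal (c * exp (- a * (y - h + real k)) + d) \<partial>measure_pmf (poisson_pmf (R * h)))
      = (\<integral>\<^sup>+k. ennreal (c * exp (- a * (y - h))) * ennreal (exp (- a * real k)) + ennreal d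
          \<partial>measure_pmf (poisson_pmf (R * h)))"
  proof (intro nn_integral_cong)
    fix k
    have "c * exp (- a * (y - h + real k)) = c * exp (- a * (y - h)) * exp (- a * real k)"
      by (simp add: exp_add[symmetric] algebra_simps)
    thus "ennreal (c * exp (- a * (y - h + real k)) + d)
        = ennreal (c * exp (- a * (y - h))) * ennreal (exp (- a * real k)) + ennreal d"
      using assms by (simp add: ennreal_plus ennreal_mult[symmetric])
  qed
  also have "\<dots> = ennreal (c * exp (- a * (y - h))) * ennreal (exp (R * h * (exp (- a) - 1))) + ennreal d"
    using assms
    by (simp add: nn_integral_add nn_integral_cmult nn_integral_exp_poisson[simplified]
        measure_pmf.emeasure_space_1[simplified])
  also have "\<dots> = ennreal (c * (exp (- a * (y - h)) * exp (R * h * (exp (- a) - 1))) + d)"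
    using assms by (simp add: ennreal_plus ennreal_mult[symmetric] mult.assoc)
  also have "exp (- a * (y - h)) * exp (R * h * (exp (- a) - 1))
      = exp (- a * y) * exp (h * (a + R * (exp (- a) - 1)))"
    by (simp add: exp_add[symmetric] algebra_simps)
  finally show ?thesis by (simp add: mult.assoc)
qed

text \<open>At a nonnegative state \<open>V\<close> coincides with a branch that is an exact
  martingale for the arrivals accepted there and dominates \<open>V\<close> wherever one step can
  lead; arrivals only add, so this is at or above \<open>y - h\<close>. Hence \<open>V\<close> is a
  supermartingale of the chain, and Markov's inequality applies.\<close>

lemma grid_interruption_le:
  fixes V :: "real \<Rightarrow> real"
  assumes M: "prob_space M" and N: "poisson_process M R0 N" and Nc: "poisson_process M Rc Nc"
    and indep: "indep_processes M N Nc" and h: "0 < h" and R: "0 < R0" "0 < Rc"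
    and root0: "\<alpha>0 + R0 * (exp (- \<alpha>0) - 1) = 0"
    and root1: "\<alpha>1 + (R0 + Rc) * (exp (- \<alpha>1) - 1) = 0"
    and V [measurable]: "V \<in> borel_measurable borel" and V0: "\<And>y. 0 \<le> V y"
    and V1: "\<And>y. y < 0 \<Longrightarrow> 1 \<le> V y"
    and low: "\<And>y. 0 \<le> y \<Longrightarrow> ereal y < T \<Longrightarrow> \<exists>c d. 0 \<le> c \<and> 0 \<le> d \<and>
      V y = c * exp (- \<alpha>1 * y) + d \<and> (\<forall>z\<ge>y - h. V z \<le> c * exp (- \<alpha>1 * z) + d)"
    and high: "\<And>y. 0 \<le> y \<Longrightarrow> T \<le> ereal y \<Longrightarrow> \<exists>c. 0 \<le> c \<and>
      V y = c * exp (- \<alpha>0 * y) \<and> (\<forall>z\<ge>y - h. V z \<le> c * exp (- \<alpha>0 * z))"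
  shows "measure M {\<omega> \<in> space M. \<exists>k\<le>n.
      grid_buffer (\<lambda>t. N t \<omega>) (\<lambda>t. Nc t \<omega>) D (\<lambda>y. ereal y < T) h k < 0} \<le> V D"
proof -
  interpret prob_space M by fact
  let ?S = "count_space UNIV \<Otimes>\<^sub>M count_space UNIV :: (nat \<times> nat) measure"
  let ?P = "\<lambda>y. ereal y < T"
  define X where "X i \<omega> = (N (real (Suc i) * h) \<omega> - N (real i * h) \<omega>,
      Nc (real (Suc i) * h) \<omega> - Nc (real i * h) \<omega>)" for i \<omega>
  define y where "y \<omega> = grid_buffer (\<lambda>t. N t \<omega>) (\<lambda>t. Nc t \<omega>) D ?P h" for \<omega>
  \<comment> \<open>the chain frozen once it is negative, so that a single time suffices in Markov's inequality\<close>
  define s where "s w = (if fst w < 0 then fst w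
      else if ?P (fst w) then fst w - h + real (fst (snd w)) + real (snd (snd w))
      else fst w - h + real (fst (snd w)))" for w :: "real \<times> nat \<times> nat"
  define z where "z k \<omega> = rec_nat D (\<lambda>k v. s (v, X k \<omega>)) k" for k \<omega>
  have z0: "z 0 \<omega> = D" and zS: "z (Suc k) \<omega> = s (z k \<omega>, X k \<omega>)" for k \<omega>
    by (simp_all add: z_def)
  \<comment> \<open>Using \<open>Suc n\<close> keeps the index set nonempty, as the pairing of
    increments requires.\<close>
  have X: "indep_vars (\<lambda>_. ?S) X {..<Suc n}"
    and dX: "\<And>k. k < Suc n \<Longrightarrow> distr M ?S (X k)
      = measure_pmf (poisson_pmf (R0 * h)) \<Otimes>\<^sub>M measure_pmf (poisson_pmf (Rc * h))"
    unfolding X_def using poisson_increments_indep_Pair[OF M N Nc indep h, of "Suc n"] by simp_all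
  have step: "(\<integral>\<^sup>+b. ennreal (V (s (v, b))) \<partial>distr M ?S (X k)) \<le> ennreal (V v)"
    if "k < Suc n" for k v
  proof -
    have eq: "(\<integral>\<^sup>+b. ennreal (V (s (v, b))) \<partial>distr M ?S (X k))
      = (\<integral>\<^sup>+a. \<integral>\<^sup>+b. ennreal (V (s (v, a, b))) \<partial>measure_pmf (poisson_pmf (Rc * h))
          \<partial>measure_pmf (poisson_pmf (R0 * h)))"
      unfolding dX[OF that] by (simp add: nn_integral_pair_pmf_nat[symmetric])
    consider "v < 0" | "0 \<le> v" "?P v" | "0 \<le> v" "T \<le> ereal v" by force
    thus ?thesis
    proof cases
      case 1
      thus ?thesis
        unfolding eq by (simp add: s_def measure_pmf.emeasure_space_1[simplified])
    next
      case 2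
      obtain c d where cd: "0 \<le> c" "0 \<le> d" "V v = c * exp (- \<alpha>1 * v) + d"
        "\<And>z. z \<ge> v - h \<Longrightarrow> V z \<le> c * exp (- \<alpha>1 * z) + d" using low[OF 2] by blast
      \<comment> \<open>Costly arrivals are integrated first, free ones second; the equation
        \<open>root1\<close> applies to the combined rate only.\<close>
      have "(\<integral>\<^sup>+b. ennreal (V (s (v, a, b))) \<partial>measure_pmf (poisson_pmf (Rc * h)))
        \<le> ennreal (c * exp (h * (\<alpha>1 + Rc * (exp (- \<alpha>1) - 1)))
            * exp (- \<alpha>1 * (v + real a)) + d)" for a
      proof -
        have "(\<integral>\<^sup>+b. ennreal (V (s (v, a, b))) \<partial>measure_pmf (poisson_pmf (Rc * h)))
          \<le> (\<integral>\<^sup>+b. ennreal (c * exp (- \<alpha>1 * ((v + real a) - h + real b)) + d)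
               \<partial>measure_pmf (poisson_pmf (Rc * h)))"
          using 2 cd(4)[of "v + real a - h + real b" for b]
          by (intro nn_integral_mono ennreal_leI) (simp add: s_def algebra_simps)
        also have "\<dots> = ennreal (c * exp (h * (\<alpha>1 + Rc * (exp (- \<alpha>1) - 1)))
            * exp (- \<alpha>1 * (v + real a)) + d)"
          using nn_integral_exp_step[OF R(2) h cd(1,2)] by (simp add: mult_ac)
        finally show ?thesis .
      qed
      \<comment> \<open>Writing \<open>v\<close> as \<open>(v + h) - h\<close> compensates for the
        drift, which the first integral has already used up.\<close>
      hence "(\<integral>\<^sup>+b. ennreal (V (s (v, b))) \<partial>distr M ?S (X k))
          \<le> (\<integral>\<^sup>+a. ennreal (c * exp (h * (\<alpha>1 + Rc * (exp (- \<alpha>1) - 1)))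
            * exp (- \<alpha>1 * ((v + h) - h + real a)) + d) \<partial>measure_pmf (poisson_pmf (R0 * h)))"
        unfolding eq by (intro nn_integral_mono) simp
      also have "\<dots> = ennreal (c * (exp (h * (\<alpha>1 + Rc * (exp (- \<alpha>1) - 1)))
          * exp (- \<alpha>1 * (v + h)) * exp (h * (\<alpha>1 + R0 * (exp (- \<alpha>1) - 1)))) + d)"
        using cd(1) by (subst nn_integral_exp_step[OF R(1) h _ cd(2)]) (simp_all add: mult_ac)
      also have "exp (h * (\<alpha>1 + Rc * (exp (- \<alpha>1) - 1)))
          * exp (- \<alpha>1 * (v + h)) * exp (h * (\<alpha>1 + R0 * (exp (- \<alpha>1) - 1)))
          = exp (- \<alpha>1 * v + h * (\<alpha>1 + (R0 + Rc) * (exp (- \<alpha>1) - 1)))"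
        unfolding exp_add[symmetric] by (simp add: algebra_simps)
      also have "ennreal (c * \<dots> + d) = ennreal (V v)" unfolding root1 cd(3) by simp
      finally show ?thesis .
    next
      case 3
      obtain c where c: "0 \<le> c" "V v = c * exp (- \<alpha>0 * v)"
        "\<And>z. z \<ge> v - h \<Longrightarrow> V z \<le> c * exp (- \<alpha>0 * z)" using high[OF 3] by blast
      \<comment> \<open>At or above the threshold costly arrivals are refused, so the integral over
        them is trivial.\<close>
      have "(\<integral>\<^sup>+b. ennreal (V (s (v, b))) \<partial>distr M ?S (X k))
        = (\<integral>\<^sup>+a. ennreal (V (v - h + real a)) \<partial>measure_pmf (poisson_pmf (R0 * h)))"
        using 3 unfolding eq
        by (simp add: s_def measure_pmf.emeasure_space_1[simplified] not_less[symmetric])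
      also have "\<dots> \<le> (\<integral>\<^sup>+a. ennreal (c * exp (- \<alpha>0 * (v - h + real a)) + 0)
          \<partial>measure_pmf (poisson_pmf (R0 * h)))"
        using c(3)[of "v - h + real a" for a] by (intro nn_integral_mono ennreal_leI) simp
      also have "\<dots> = ennreal (V v)"
        by (subst nn_integral_exp_step[OF R(1) h c(1) order_refl]) (simp add: root0 c(2))
      finally show ?thesis .
    qed
  qed
  have s [measurable]: "s \<in> borel_measurable (borel \<Otimes>\<^sub>M ?S)"
    unfolding s_def[abs_def] by measurable
  have "(\<integral>\<^sup>+\<omega>. ennreal (V (z n \<omega>)) \<partial>M) \<le> ennreal (V D)"
    by (rule nn_integral_chain_le[OF X z0 zS, where Q = borel]) (use step in auto)
  have zy: "((\<exists>k\<le>j. y \<omega> k < 0) \<longrightarrow> z j \<omega> < 0) \<and> (\<not> (\<exists>k\<le>j. y \<omega> k < 0) \<longrightarrow> z j \<omega> = y \<omega> j)" for j \<omega>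
  proof (induction j)
    case (Suc j)
    show ?case
    proof (cases "\<exists>k\<le>j. y \<omega> k < 0")
      case True
      thus ?thesis using Suc by (auto simp: zS s_def le_Suc_eq)
    next
      case False
      hence "z (Suc j) \<omega> = y \<omega> (Suc j)"
        using Suc by (auto simp: zS s_def y_def X_def Let_def not_less)
      thus ?thesis using False by (auto simp: le_Suc_eq)
    qed
  qed (simp add: z0 y_def)
  have "z n \<in> borel_measurable M"
  proof -
    have "z k \<in> borel_measurable M" if "k \<le> n" for k
      using that
    proof (induction k)
      case (Suc k)
      hence [measurable]: "z k \<in> borel_measurable M" "X k \<in> measurable M ?S"
        using X by (auto simp: indep_vars_def)
      show ?case unfolding zS[abs_def] by measurable
    qed (simp add: z0[abs_def])
    thus ?thesis by simp
  qed
  note this [measurable]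
  have "{\<omega> \<in> space M. \<exists>k\<le>n. y \<omega> k < 0} \<subseteq> {\<omega> \<in> space M. z n \<omega> < 0}"
    using zy[of n] by blast
  hence "emeasure M {\<omega> \<in> space M. \<exists>k\<le>n. y \<omega> k < 0} \<le> emeasure M {\<omega> \<in> space M. z n \<omega> < 0}"
    by (intro emeasure_mono) measurable
  also have "\<dots> = (\<integral>\<^sup>+\<omega>. indicator {\<omega> \<in> space M. z n \<omega> < 0} \<omega> \<partial>M)"
    by (intro nn_integral_indicator[symmetric]) measurable
  also have "\<dots> \<le> (\<integral>\<^sup>+\<omega>. ennreal (V (z n \<omega>)) \<partial>M)"
    using V1 by (intro nn_integral_mono) (auto simp: indicator_def)
  also have "\<dots> \<le> ennreal (V D)" by fact
  finally show ?thesis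
    using V0 unfolding y_def emeasure_eq_measure by simp
qed

lemma poisson_process_measurable:
  "poisson_process M R N \<Longrightarrow> 0 \<le> t \<Longrightarrow> N t \<in> measurable M (count_space UNIV)"
  by (simp add: poisson_process_def)

lemma poisson_process_counting_path:
  "poisson_process M R N \<Longrightarrow> \<omega> \<in> space M \<Longrightarrow> counting_path (\<lambda>t. N t \<omega>)"
  by (simp add: poisson_process_def counting_path_def)

section \<open>Feasibility from a supermartingale\<close>

lemma risky_policy_is_policy: "is_policy (risky_policy T)"
  unfolding is_policy_def risky_policy_def by auto

lemma risky_policy_controlled_buffer_exists:
  assumes N: "poisson_process M R0 N" and Nc: "poisson_process M Rc Nc"
  shows "\<exists>x u. controlled_buffer M N Nc (risky_policy T) D x u"
proof -
  define w where "w \<omega> = buffer_weight (\<lambda>t. N t \<omega>) (\<lambda>t. Nc t \<omega>) D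
      (\<lambda>y. 0 \<le> y \<and> ereal y < T)" for \<omega>
  define x where "x t \<omega> = buffer (\<lambda>t. N t \<omega>) (\<lambda>t. Nc t \<omega>) D (w \<omega>) t" for t \<omega>
  define u where "u t \<omega> = (if 0 < x t \<omega> \<and> ereal (x t \<omega>) < T then 1 else 0 :: nat)" for t \<omega>
  have x: "x t \<omega> = D + real (N t \<omega>)
      + real (action_integral (\<lambda>s. u s \<omega>) (\<lambda>s. Nc s \<omega>) t) - t" if "\<omega> \<in> space M" for t \<omega>
    unfolding x_def
  proof (rule buffer_controlled_path)
    show "counting_path (\<lambda>t. N t \<omega>)" "counting_path (\<lambda>t. Nc t \<omega>)"
      using poisson_process_counting_path[OF N that] poisson_process_counting_path[OF Nc that] by blast+
    thus "buffer_solution (\<lambda>t. N t \<omega>) (\<lambda>t. Nc t \<omega>) D (\<lambda>y. 0 \<le> y \<and> ereal y < T) (w \<omega>)"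
      unfolding w_def by (intro buffer_solution_exists)
  qed (simp only: u_def x_def)
  have "controlled_buffer M N Nc (risky_policy T) D x u"
    unfolding controlled_buffer_def
  proof (intro ballI allI impI conjI)
    show "u t \<omega> = risky_policy T t (\<lambda>s. x s \<omega>) (\<lambda>s. u s \<omega>)" for t \<omega>
      by (simp only: u_def risky_policy_def)
  qed (rule x)
  thus ?thesis by blast
qed

text \<open>The chain also uses the costly server at negative levels;
  \<open>buffer_interruption_cong\<close> removes this difference. The right-hand side is free of
  \<open>x\<close> and \<open>u\<close>, so one bound covers all solutions.\<close>

lemma interruption_eq_grid:
  assumes N: "poisson_process M R0 N" and Nc: "poisson_process M Rc Nc"
    and x: "controlled_buffer M N Nc (risky_policy T) D x u"
  shows "interruption M x = {\<omega> \<in> space M. \<exists>i j. eventually (\<lambda>k. grid_buffer (\<lambda>t. N t \<omega>)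
    (\<lambda>t. Nc t \<omega>) D (\<lambda>y. ereal y < T) (1 / 2 ^ k) (j * 2 ^ (k - i)) < 0) sequentially}"
proof -
  have "(\<exists>t\<ge>0. x t \<omega> \<le> 0) \<longleftrightarrow> (\<exists>i j. eventually (\<lambda>k. grid_buffer (\<lambda>t. N t \<omega>)
    (\<lambda>t. Nc t \<omega>) D (\<lambda>y. ereal y < T) (1 / 2 ^ k) (j * 2 ^ (k - i)) < 0) sequentially)"
    if "\<omega> \<in> space M" for \<omega>
  proof -
    note n = poisson_process_counting_path[OF N that]
    note m = poisson_process_counting_path[OF Nc that]
    have u: "u t \<omega> = (if 0 < x t \<omega> \<and> ereal (x t \<omega>) < T then 1 else 0)"
      and eq: "x t \<omega> = D + real (N t \<omega>)
        + real (action_integral (\<lambda>s. u s \<omega>) (\<lambda>s. Nc s \<omega>) t) - t" if "0 \<le> t" for t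
      using x \<open>\<omega> \<in> space M\<close> that unfolding controlled_buffer_def risky_policy_def by blast+
    obtain w where w: "buffer_solution (\<lambda>t. N t \<omega>) (\<lambda>t. Nc t \<omega>) D (\<lambda>y. 0 \<le> y \<and> ereal y < T) w"
      "\<And>t. 0 \<le> t \<Longrightarrow> x t \<omega> = buffer (\<lambda>t. N t \<omega>) (\<lambda>t. Nc t \<omega>) D w t"
      using controlled_path_buffer[OF n m, of "\<lambda>t. u t \<omega>" "\<lambda>t. x t \<omega>" T D] u eq by blast
    obtain w' where w': "buffer_solution (\<lambda>t. N t \<omega>) (\<lambda>t. Nc t \<omega>) D (\<lambda>y. ereal y < T) w'"
      using buffer_solution_exists[OF m] by blast
    have "(\<exists>t\<ge>0. x t \<omega> \<le> 0) \<longleftrightarrow> (\<exists>t\<ge>0. buffer (\<lambda>t. N t \<omega>) (\<lambda>t. Nc t \<omega>) D w t \<le> 0)"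
      using w(2) by auto
    also have "\<dots> \<longleftrightarrow> (\<exists>t\<ge>0. buffer (\<lambda>t. N t \<omega>) (\<lambda>t. Nc t \<omega>) D w' t \<le> 0)"
      by (rule buffer_interruption_cong[OF n m w(1) w']) simp
    finally show ?thesis using buffer_interruption_iff_grid[OF n m w'] by simp
  qed
  thus ?thesis unfolding interruption_def by blast
qed

text \<open>On interruption, the chains of all sufficiently fine dyadic meshes become negative. Each
  does so with probability at most \<open>V D\<close> once its mesh is below
  \<open>\<delta>\<close>, and the bound passes to the limit inferior of these events.\<close>

lemma risky_policy_feasible:
  fixes V :: "real \<Rightarrow> real"
  assumes M: "prob_space M" and N: "poisson_process M R0 N" and Nc: "poisson_process M Rc Nc"
    and indep: "indep_processes M N Nc" and R: "0 < R0" "0 < Rc"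
    and root0: "\<alpha>0 + R0 * (exp (- \<alpha>0) - 1) = 0"
    and root1: "\<alpha>1 + (R0 + Rc) * (exp (- \<alpha>1) - 1) = 0"
    and V: "V \<in> borel_measurable borel" "\<And>y. 0 \<le> V y" "\<And>y. y < 0 \<Longrightarrow> 1 \<le> V y"
    and "0 < \<delta>"
    and low: "\<And>y. 0 \<le> y \<Longrightarrow> ereal y < T \<Longrightarrow> \<exists>c d. 0 \<le> c \<and> 0 \<le> d \<and>
      V y = c * exp (- \<alpha>1 * y) + d \<and> (\<forall>z. V z \<le> c * exp (- \<alpha>1 * z) + d)"
    and high: "\<And>y. 0 \<le> y \<Longrightarrow> T \<le> ereal y \<Longrightarrow> \<exists>c. 0 \<le> c \<and>
      V y = c * exp (- \<alpha>0 * y) \<and> (\<forall>z\<ge>y - \<delta>. V z \<le> c * exp (- \<alpha>0 * z))"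
    and "V D \<le> \<epsilon>"
  shows "feasible M N Nc (risky_policy T) D \<epsilon>"
proof -
  interpret prob_space M by fact
  define y where "y k l \<omega> = grid_buffer (\<lambda>t. N t \<omega>) (\<lambda>t. Nc t \<omega>) D (\<lambda>y. ereal y < T) (1 / 2 ^ k) l"
    for k l \<omega>
  have [measurable]: "y k l \<in> borel_measurable M" for k l
    unfolding y_def[abs_def]
    by (intro borel_measurable_grid_buffer poisson_process_measurable[OF N]
        poisson_process_measurable[OF Nc]) simp_all
  \<comment> \<open>Level \<open>k\<close> has mesh \<open>1 / 2 ^ k\<close> and time horizon
    \<open>k\<close>, so every fixed dyadic time is eventually covered.\<close>
  define E where "E k = {\<omega> \<in> space M. \<exists>l\<le>k * 2 ^ k. y k l \<omega> < 0}" for k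
  have [measurable]: "E k \<in> sets M" for k unfolding E_def by measurable
  have "(\<lambda>k. (1 / 2) ^ k) \<longlonglongrightarrow> (0 :: real)" by (rule LIMSEQ_power_zero) simp
  hence "eventually (\<lambda>k. (1 / 2) ^ k < \<delta>) sequentially"
    using \<open>0 < \<delta>\<close> by (rule order_tendstoD)
  then obtain K0 where K0: "\<And>k. k \<ge> K0 \<Longrightarrow> (1 / 2) ^ k < \<delta>"
    by (auto simp: eventually_sequentially)
  have E: "prob (E k) \<le> \<epsilon>" if "k \<ge> K0" for k
  proof -
    have h: "0 < (1 / 2 ^ k :: real)" "1 / 2 ^ k < \<delta>"
      using K0[OF that] by (simp_all add: power_one_over)
    have "prob (E k) \<le> V D"
      unfolding E_def y_def
    proof (rule grid_interruption_le[OF M N Nc indep h(1) R root0 root1 V])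
      fix y assume y: "0 \<le> y" "T \<le> ereal y"
      have "y - \<delta> \<le> y - 1 / 2 ^ k" using h(2) by simp
      thus "\<exists>c. 0 \<le> c \<and> V y = c * exp (- \<alpha>0 * y) \<and>
          (\<forall>z\<ge>y - 1 / 2 ^ k. V z \<le> c * exp (- \<alpha>0 * z))"
        using high[OF y] by (meson order_trans)
    next
      fix y assume "0 \<le> y" "ereal y < T"
      from low[OF this] show "\<exists>c d. 0 \<le> c \<and> 0 \<le> d \<and> V y = c * exp (- \<alpha>1 * y) + d \<and>
          (\<forall>z\<ge>y - 1 / 2 ^ k. V z \<le> c * exp (- \<alpha>1 * z) + d)" by blast
    qed
    thus ?thesis using \<open>V D \<le> \<epsilon>\<close> by simp
  qed
  \<comment> \<open>These sets increase to the limit inferior of the \<open>E k\<close>; starting at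
    \<open>max K K0\<close> keeps every mesh below \<open>\<delta>\<close>.\<close>
  define A where "A K = (\<Inter>k\<in>{max K K0..}. E k)" for K
  have AE: "A K \<subseteq> E (max K K0)" for K by (auto simp: A_def)
  have Am [measurable]: "A K \<in> sets M" for K unfolding A_def by (intro sets.countable_INT) auto
  have "incseq A" by (intro incseq_SucI) (auto simp: A_def)
  hence "(\<lambda>K. prob (A K)) \<longlonglongrightarrow> prob (\<Union>K. A K)"
    by (intro finite_Lim_measure_incseq) (auto simp: Am)
  moreover have "prob (A K) \<le> \<epsilon>" for K
  proof -
    have "prob (A K) \<le> prob (E (max K K0))" by (intro finite_measure_mono AE) simp
    also have "\<dots> \<le> \<epsilon>" by (rule E) simp
    finally show ?thesis .
  qed
  ultimately have UA: "prob (\<Union>K. A K) \<le> \<epsilon>" by (intro LIMSEQ_le_const2) auto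
  have "interruption M x \<in> sets M \<and> prob (interruption M x) \<le> \<epsilon>"
    if x: "controlled_buffer M N Nc (risky_policy T) D x u" for x u
  proof -
    have eq: "interruption M x = {\<omega> \<in> space M. \<exists>i j. \<exists>K. \<forall>k\<ge>K. y k (j * 2 ^ (k - i)) \<omega> < 0}"
      unfolding interruption_eq_grid[OF N Nc x] y_def eventually_sequentially ..
    have "interruption M x \<in> sets M" unfolding eq by measurable
    moreover have "interruption M x \<subseteq> (\<Union>K. A K)"
    proof
      fix \<omega> assume "\<omega> \<in> interruption M x"
      then obtain i j K where \<omega>: "\<omega> \<in> space M" "\<And>k. k \<ge> K \<Longrightarrow> y k (j * 2 ^ (k - i)) \<omega> < 0"
        unfolding eq by blast
      have "\<omega> \<in> E k" if "k \<ge> max (max K j) K0" for k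
      proof -
        have "j * 2 ^ (k - i) \<le> k * 2 ^ k"
          using that by (intro mult_mono power_increasing) auto
        thus ?thesis using \<omega>(1) \<omega>(2)[of k] that by (auto simp: E_def)
      qed
      thus "\<omega> \<in> (\<Union>K. A K)" by (auto simp: A_def intro!: exI[of _ "max K j"])
    qed
    hence "prob (interruption M x) \<le> prob (\<Union>K. A K)" by (intro finite_measure_mono) auto
    ultimately show ?thesis using UA by simp
  qed
  thus ?thesis unfolding feasible_def
    using risky_policy_is_policy risky_policy_controlled_buffer_exists[OF N Nc] by blast
qed

section \<open>Exponents and the supermartingale\<close>

text \<open>The root set is closed and bounded above by \<open>R\<close>, so its supremum is a root.
  It is positive because the intermediate value theorem yields a root between \<open>ln R\<close>
  and \<open>R\<close>.\<close>

lemma rbar_root: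
  assumes "R > 1"
  shows "rbar R + R * (exp (- rbar R) - 1) = 0" "0 < rbar R" "rbar R \<le> R"
    and "\<And>r. r + R * (exp (- r) - 1) = 0 \<Longrightarrow> r \<le> rbar R"
proof -
  define f where "f r = r + R * (exp (- r) - 1)" for r
  let ?S = "{r. f r = 0}"
  have cont: "continuous_on X f" for X unfolding f_def by (intro continuous_intros)
  have le: "r \<le> R" if "f r = 0" for r
  proof -
    have "r = R - R * exp (- r)" using that by (simp add: f_def algebra_simps)
    thus ?thesis using assms by (smt (verit) exp_gt_zero mult_pos_pos)
  qed
  have bdd: "bdd_above ?S" using le by (auto intro!: bdd_aboveI)
  \<comment> \<open>\<open>ln R\<close> is the minimizer of \<open>f\<close>, with value
    \<open>ln R + 1 - R\<close>.\<close>
  have "f (ln R) \<le> 0"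
  proof -
    have "R * exp (- ln R) = 1" using assms by (simp add: exp_minus)
    thus ?thesis using assms ln_le_minus_one[of R] by (simp add: f_def right_diff_distrib)
  qed
  moreover have "0 \<le> f R" using assms by (simp add: f_def algebra_simps)
  moreover have "ln R \<le> R" using assms ln_le_minus_one[of R] by simp
  ultimately obtain r where r: "ln R \<le> r" "f r = 0"
    using IVT'[of f "ln R" 0 R] cont by blast
  have closed: "closed ?S"
    using continuous_closed_preimage_constant[of UNIV f 0] cont by simp
  have Sup: "rbar R = Sup ?S" by (simp add: rbar_def f_def)
  have "Sup ?S \<in> ?S" using r bdd closed by (intro closed_contains_Sup) auto
  hence root: "f (rbar R) = 0" by (simp add: Sup)
  have upper: "r \<le> rbar R" if "f r = 0" for r
    unfolding Sup using that bdd by (intro cSup_upper) auto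
  show "rbar R + R * (exp (- rbar R) - 1) = 0" using root by (simp add: f_def)
  show "0 < rbar R" using upper[OF r(2)] r(1) assms ln_gt_zero[of R] by linarith
  show "rbar R \<le> R" using le root by blast
  show "r \<le> rbar R" if "r + R * (exp (- r) - 1) = 0" for r
    using upper that by (simp add: f_def)
qed

text \<open>Raising the rate makes the function negative at the old root, while it is nonnegative at
  \<open>R'\<close>, so a root lies strictly beyond the old one.\<close>

lemma rbar_less:
  assumes "1 < R" "R < R'"
  shows "rbar R < rbar R'"
proof -
  define f where "f r = r + R' * (exp (- r) - 1)" for r
  let ?a = "rbar R"
  note a = rbar_root[OF assms(1)]
  have "f ?a = (R' - R) * (exp (- ?a) - 1)" using a(1) by (simp add: f_def algebra_simps)
  also have "\<dots> < 0" using assms a(2) by (simp add: mult_pos_neg)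
  finally have neg: "f ?a < 0" .
  moreover have "0 \<le> f R'" using assms by (simp add: f_def algebra_simps)
  moreover have "continuous_on {?a..R'} f" unfolding f_def by (intro continuous_intros)
  ultimately obtain r where r: "?a \<le> r" "f r = 0"
    using IVT'[of f ?a 0 R'] a(3) assms by force
  hence "?a < r" using neg by (metis order_le_less less_irrefl)
  also have "r \<le> rbar R'" using rbar_root(4)[of R' r] r(2) assms by (simp add: f_def)
  finally show ?thesis .
qed

text \<open>The difference of the two sides vanishes at \<open>s = 0\<close> and has a nonnegative
  derivative. This gives domination by the lower branch above the threshold.\<close>

lemma one_minus_exp_ratio_antimono:
  fixes a b s :: real
  assumes "0 \<le> a" "a \<le> b" "0 \<le> s"
  shows "a * (1 - exp (- b * s)) \<le> b * (1 - exp (- a * s))"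
proof -
  define f where "f s = b * (1 - exp (- a * s)) - a * (1 - exp (- b * s))" for s
  have "f 0 \<le> f s"
  proof (rule DERIV_nonneg_imp_nondecreasing[OF assms(3)])
    fix t :: real assume "0 \<le> t" "t \<le> s"
    have "(f has_real_derivative a * b * (exp (- a * t) - exp (- b * t))) (at t)"
      unfolding f_def by (auto intro!: derivative_eq_intros simp: algebra_simps)
    moreover have "0 \<le> a * b * (exp (- a * t) - exp (- b * t))"
      using assms \<open>0 \<le> t\<close> by (simp add: mult_right_mono)
    ultimately show "\<exists>D. DERIV f t :> D \<and> 0 \<le> D" by blast
  qed
  thus ?thesis by (simp add: f_def)
qed

text \<open>The left side is bounded by \<open>exp x - 1 \<le> x * exp x\<close>, the right one by
  \<open>x \<le> exp x - 1\<close>. The surplus factor \<open>exp (\<alpha>1 * v)\<close> is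
  absorbed by \<open>q\<close>, which limits the range of \<open>v\<close>. This gives domination by
  the upper branch just below the threshold.\<close>

lemma exp_minus_one_le_near_zero:
  fixes \<alpha>0 \<alpha>1 A c q v :: real
  assumes "0 \<le> A" "0 \<le> c" "0 < q" "0 < \<alpha>0" "0 < \<alpha>1" "0 \<le> v"
    and A: "A * \<alpha>1 \<le> c * \<alpha>0 * q" and v: "v \<le> - ln q / \<alpha>1"
  shows "A * (exp (\<alpha>1 * v) - 1) \<le> c * (exp (\<alpha>0 * v) - 1)"
proof -
  have "\<alpha>1 * v \<le> - ln q" using v assms(5) by (simp add: field_simps)
  hence q: "q * exp (\<alpha>1 * v) \<le> 1"
  proof -
    have "exp (\<alpha>1 * v) \<le> exp (- ln q)" using \<open>\<alpha>1 * v \<le> - ln q\<close> by simp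
    also have "\<dots> = 1 / q" using assms(3) by (simp add: exp_minus field_simps)
    finally show ?thesis using assms(3) by (simp add: field_simps)
  qed
  have "1 - \<alpha>1 * v \<le> exp (- (\<alpha>1 * v))" using exp_ge_add_one_self[of "- (\<alpha>1 * v)"] by simp
  hence "(1 - \<alpha>1 * v) * exp (\<alpha>1 * v) \<le> exp (- (\<alpha>1 * v)) * exp (\<alpha>1 * v)"
    by (intro mult_right_mono) simp_all
  hence "exp (\<alpha>1 * v) - 1 \<le> \<alpha>1 * v * exp (\<alpha>1 * v)"
    by (simp add: exp_minus algebra_simps)
  hence "A * (exp (\<alpha>1 * v) - 1) \<le> A * (\<alpha>1 * v * exp (\<alpha>1 * v))"
    using assms(1) by (rule mult_left_mono)
  also have "\<dots> = A * \<alpha>1 * (v * exp (\<alpha>1 * v))" by simp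
  also have "\<dots> \<le> c * \<alpha>0 * q * (v * exp (\<alpha>1 * v))"
    using assms(6) by (intro mult_right_mono[OF A]) simp
  also have "\<dots> = c * \<alpha>0 * v * (q * exp (\<alpha>1 * v))" by simp
  also have "\<dots> \<le> c * \<alpha>0 * v * 1" using assms q by (intro mult_left_mono) simp_all
  also have "\<dots> \<le> c * (exp (\<alpha>0 * v) - 1)"
  proof -
    have "\<alpha>0 * v \<le> exp (\<alpha>0 * v) - 1" using exp_ge_add_one_self[of "\<alpha>0 * v"] by linarith
    from mult_left_mono[OF this assms(2)] show ?thesis by (simp add: mult.assoc)
  qed
  finally show ?thesis .
qed

section \<open>The threshold as a bound on the initial value of \<open>V\<close>\<close>

lemma risky_beta_gt_1:
  assumes "0 < \<alpha>0" "\<alpha>0 < \<alpha>1" "\<alpha>0 < 2"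
  shows "1 < risky_beta \<alpha>0 \<alpha>1"
proof -
  have "\<alpha>0 * (1 - \<alpha>0 / 2) < \<alpha>0 * 1" using assms by (intro mult_strict_left_mono) simp_all
  hence "\<alpha>0 * (1 - \<alpha>0 / 2) < \<alpha>1" using assms(2) by linarith
  moreover have "0 < \<alpha>0 * (1 - \<alpha>0 / 2)" using assms by simp
  ultimately show ?thesis using assms by (simp add: risky_beta_def)
qed

text \<open>The last two conclusions are \<open>V D \<le> \<epsilon>\<close> on the lower and the
  upper branch of the supermartingale; \<open>\<beta> * w < 1\<close> makes the lower coefficient
  positive.\<close>

lemma finite_threshold_bounds:
  fixes \<alpha>0 \<alpha>1 D \<epsilon> \<tau> :: real
  defines "\<beta> \<equiv> risky_beta \<alpha>0 \<alpha>1" and "w \<equiv> exp (- \<alpha>1 * \<tau>)" and "q \<equiv> exp (- \<alpha>1 * D)"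
  assumes a: "0 < \<alpha>0" "\<alpha>0 < \<alpha>1" "\<alpha>0 < 2"
    and reg: "(D, \<epsilon>) \<in> nontrivial_region \<alpha>0 \<alpha>1" and T: "Tstar \<alpha>0 \<alpha>1 D \<epsilon> \<le> ereal \<tau>"
  shows "0 < \<tau>" and "\<beta> * w < 1"
    and "D < \<tau> \<Longrightarrow> (1 - \<beta> * w) / (1 - w) * q + (1 - (1 - \<beta> * w) / (1 - w)) \<le> \<epsilon>"
    and "\<tau> \<le> D \<Longrightarrow> \<beta> * w * exp (- \<alpha>0 * (D - \<tau>)) \<le> \<epsilon>"
proof -
  have \<beta>: "1 < \<beta>" unfolding \<beta>_def using a by (rule risky_beta_gt_1)
  have \<epsilon>: "0 < \<epsilon>" "\<epsilon> < 1" and "1 / \<alpha>1 * ln (1 / \<epsilon>) \<le> D" "D \<le> 1 / \<alpha>0 * ln (1 / \<epsilon>)"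
    using reg by (simp_all add: nontrivial_region_def)
  hence D1: "- ln \<epsilon> \<le> \<alpha>1 * D" and D0: "\<alpha>0 * D \<le> - ln \<epsilon>"
    using a by (simp_all add: ln_div field_simps)
  have "0 < q" by (simp add: q_def)
  moreover have "ln q \<le> ln \<epsilon>" using D1 by (simp add: q_def)
  ultimately have q: "0 < q" "q \<le> \<epsilon>" using \<epsilon>(1) by simp_all
  have w0: "0 < w" by (simp add: w_def)
  have ln_bound: "ln (\<beta> / \<epsilon>) = ln \<beta> - ln \<epsilon>" using \<beta> \<epsilon> by (simp add: ln_div)
  \<comment> \<open>Clearing the denominator turns the bound on the lower branch into a polynomial
    inequality.\<close>
  have cancel: "(1 - \<beta> * w) / (1 - w) * q + (1 - (1 - \<beta> * w) / (1 - w)) \<le> \<epsilon>"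
    if "w < 1" "q - w + \<beta> * w * (1 - q) \<le> \<epsilon> * (1 - w)"
  proof -
    have "(1 - \<beta> * w) / (1 - w) * q + (1 - (1 - \<beta> * w) / (1 - w))
        = (q - w + \<beta> * w * (1 - q)) / (1 - w)"
      using that(1) by (simp add: divide_simps) (simp add: algebra_simps)
    also have "\<dots> \<le> \<epsilon>" using that by (simp add: field_simps)
    finally show ?thesis .
  qed
  have "0 < \<tau> \<and> \<beta> * w < 1 \<and>
    (D < \<tau> \<longrightarrow> (1 - \<beta> * w) / (1 - w) * q + (1 - (1 - \<beta> * w) / (1 - w)) \<le> \<epsilon>) \<and>
    (\<tau> \<le> D \<longrightarrow> \<beta> * w * exp (- \<alpha>0 * (D - \<tau>)) \<le> \<epsilon>)"
  proof (cases "D \<ge> risky_Dbar \<alpha>0 \<alpha>1 \<epsilon>")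
    case True
    hence "ln \<beta> - ln \<epsilon> \<le> \<alpha>1 * D"
      using a ln_bound by (simp add: risky_Dbar_def \<beta>_def field_simps)
    hence "ln (\<beta> * q) \<le> ln \<epsilon>" using \<beta> by (simp add: ln_mult q_def)
    hence \<beta>q: "\<beta> * q \<le> \<epsilon>" using \<beta> \<epsilon> q(1) by simp
    have "1 / (\<alpha>1 - \<alpha>0) * (ln (\<beta> / \<epsilon>) - \<alpha>0 * D) \<le> \<tau>"
      using T True by (simp add: Tstar_def Tstar_large_def \<beta>_def)
    \<comment> \<open>This is the logarithm of the bound on the upper branch. Combined with
      \<open>D0\<close> it also yields \<open>\<beta> * w < 1\<close>.\<close>
    hence large: "ln \<beta> - ln \<epsilon> - \<alpha>0 * D \<le> (\<alpha>1 - \<alpha>0) * \<tau>"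
      using a by (simp add: ln_bound pos_divide_le_eq mult.commute)
    have ln\<beta>: "0 < ln \<beta>" using \<beta> by simp
    with large D0 have "0 < (\<alpha>1 - \<alpha>0) * \<tau>" by linarith
    hence \<tau>: "0 < \<tau>" using a by (simp add: zero_less_mult_iff)
    have "ln \<beta> - \<alpha>1 * \<tau> \<le> - (\<alpha>0 * \<tau>)" using large D0 by (simp add: algebra_simps)
    moreover have "0 < \<alpha>0 * \<tau>" using a \<tau> by simp
    ultimately have "ln (\<beta> * w) < ln 1" using \<beta> by (simp add: ln_mult w_def)
    hence c: "\<beta> * w < 1" using \<beta> w0 by (simp only: ln_less_cancel_iff mult_pos_pos zero_less_one less_trans[OF zero_less_one])
    have "q - w + \<beta> * w * (1 - q) \<le> \<epsilon> * (1 - w)" if "D < \<tau>"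
    proof -
      have wq: "w \<le> q" "w < 1" using that \<tau> a by (simp_all add: w_def q_def)
      \<comment> \<open>The product is exactly the difference of the two sides of the next
        inequality.\<close>
      have "0 \<le> (\<beta> - 1) * (q - w)" using \<beta> wq by simp
      hence "q - w + \<beta> * w * (1 - q) \<le> \<beta> * q * (1 - w)" by (simp add: algebra_simps)
      also have "\<dots> \<le> \<epsilon> * (1 - w)" using \<beta>q wq by (intro mult_right_mono) simp_all
      finally show ?thesis .
    qed
    moreover have "w < 1" using \<tau> a by (simp add: w_def)
    moreover have "\<beta> * w * exp (- \<alpha>0 * (D - \<tau>)) \<le> \<epsilon>"
    proof -
      have "ln (\<beta> * w * exp (- \<alpha>0 * (D - \<tau>))) = ln \<beta> - \<alpha>1 * \<tau> - \<alpha>0 * (D - \<tau>)"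
        using \<beta> by (simp add: ln_mult w_def)
      also have "\<dots> \<le> ln \<epsilon>" using large by (simp add: algebra_simps)
      finally show ?thesis using \<beta> w0 \<epsilon>(1) by (subst (asm) ln_le_cancel_iff) simp_all
    qed
    ultimately show ?thesis using \<tau> c cancel by blast
  next
    case False
    hence "\<alpha>1 * D < ln \<beta> - ln \<epsilon>"
      using a ln_bound by (simp add: risky_Dbar_def \<beta>_def field_simps)
    hence "ln \<epsilon> < ln (\<beta> * q)" using \<beta> by (simp add: ln_mult q_def)
    hence \<beta>q: "\<epsilon> < \<beta> * q" using \<beta> \<epsilon> q(1) by simp
    define X where "X = \<epsilon> + \<beta> * (1 - q) - 1"
    \<comment> \<open>Equality would make the threshold infinite, against the finite
      \<open>\<tau>\<close>.\<close>
    have "\<epsilon> \<noteq> q" using T False by (auto simp: Tstar_def Tstar_small_def q_def)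
    hence qe: "q < \<epsilon>" using q by simp
    have "1 / \<alpha>1 * ln (X / (\<epsilon> - q)) \<le> \<tau>"
      using T False \<open>\<epsilon> \<noteq> q\<close> by (simp add: Tstar_def Tstar_small_def q_def \<beta>_def X_def)
    hence lnX: "ln (X / (\<epsilon> - q)) \<le> \<alpha>1 * \<tau>" using a by (simp add: field_simps)
    have "1 - q < \<beta> * (1 - q)" using \<beta> qe \<epsilon> by simp
    hence X: "\<epsilon> - q < X" by (simp add: X_def)
    hence "0 < ln (X / (\<epsilon> - q))" using qe by simp
    with lnX have "0 < \<alpha>1 * \<tau>" by linarith
    hence \<tau>: "0 < \<tau>" using a by (simp add: zero_less_mult_iff)
    hence w1: "w < 1" using a by (simp add: w_def)
    have "0 < X / (\<epsilon> - q)" using X qe by simp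
    hence "X / (\<epsilon> - q) = exp (ln (X / (\<epsilon> - q)))" by (rule exp_ln[symmetric])
    also have "\<dots> \<le> exp (\<alpha>1 * \<tau>)" using lnX by (rule iffD2[OF exp_le_cancel_iff])
    finally have "X / (\<epsilon> - q) \<le> exp (\<alpha>1 * \<tau>)" .
    hence "X \<le> exp (\<alpha>1 * \<tau>) * (\<epsilon> - q)" using qe by (simp add: field_simps)
    hence "w * X \<le> w * (exp (\<alpha>1 * \<tau>) * (\<epsilon> - q))" using w0 by simp
    also have "\<dots> = \<epsilon> - q" by (simp add: w_def exp_minus)
    finally have wX: "w * X \<le> \<epsilon> - q" .
    hence small: "q - w + \<beta> * w * (1 - q) \<le> \<epsilon> * (1 - w)" by (simp add: X_def algebra_simps)
    \<comment> \<open>Here \<open>D\<close> below \<open>risky_Dbar\<close> forces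
      \<open>w < q\<close>, that is \<open>D < \<tau>\<close>, so only the lower branch can
      occur.\<close>
    have "\<epsilon> * (1 - q) < \<beta> * q * (1 - q)" using \<beta>q qe \<epsilon> by (intro mult_strict_right_mono) simp_all
    hence "\<epsilon> - q < q * X" by (simp add: X_def algebra_simps)
    with wX have "w * X < q * X" by linarith
    hence "w < q" using X qe by (simp add: mult_less_cancel_right)
    hence D\<tau>: "D < \<tau>" using a by (simp add: w_def q_def)
    have "\<epsilon> * (1 - w) < 1 - w" using \<epsilon> w1 by simp
    hence "\<beta> * w * (1 - q) < 1 * (1 - q)" using small by simp
    hence c: "\<beta> * w < 1" using qe \<epsilon> by (simp add: mult_less_cancel_right)
    show ?thesis using \<tau> c D\<tau> cancel[OF w1 small] by simp
  qed
  thus "0 < \<tau>" and "\<beta> * w < 1"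
    and "D < \<tau> \<Longrightarrow> (1 - \<beta> * w) / (1 - w) * q + (1 - (1 - \<beta> * w) / (1 - w)) \<le> \<epsilon>"
    and "\<tau> \<le> D \<Longrightarrow> \<beta> * w * exp (- \<alpha>0 * (D - \<tau>)) \<le> \<epsilon>"
    by simp_all
qed

section \<open>Choice of the supermartingale for the given threshold\<close>

theorem theorem5:
  fixes M :: "'a measure" and N Nc :: "real \<Rightarrow> 'a \<Rightarrow> nat"
    and R0 Rc R1 \<alpha>0 \<alpha>1 D \<epsilon> :: real and T :: ereal
  assumes "R0 > 1" and "Rc > 0" and "R1 = R0 + Rc"
    and "\<alpha>0 = rbar R0" and "\<alpha>1 = rbar R1"
    and "\<alpha>0 < 2"
    and "prob_space M"
    and "poisson_process M R0 N" and "poisson_process M Rc Nc"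
    and "indep_processes M N Nc"
    and "(D, \<epsilon>) \<in> nontrivial_region \<alpha>0 \<alpha>1"
    and "T \<ge> Tstar \<alpha>0 \<alpha>1 D \<epsilon>"
  shows "feasible M N Nc (risky_policy T) D \<epsilon>"
proof -
  have root0: "\<alpha>0 + R0 * (exp (- \<alpha>0) - 1) = 0" and a0: "0 < \<alpha>0"
    using rbar_root[OF assms(1)] assms(4) by simp_all
  have root1: "\<alpha>1 + (R0 + Rc) * (exp (- \<alpha>1) - 1) = 0"
    using rbar_root(1)[of R1] assms(1,2,3,5) by simp
  have a1: "\<alpha>0 < \<alpha>1" using rbar_less[of R0 R1] assms(1-5) by simp
  have R: "0 < R0" "0 < Rc" using assms(1,2) by simp_all
  have \<epsilon>: "0 < \<epsilon>" "1 / \<alpha>1 * ln (1 / \<epsilon>) \<le> D" using assms(11) by (simp_all add: nontrivial_region_def)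
  note feasibleI = risky_policy_feasible[OF assms(7-10) R root0 root1]
  show ?thesis
  proof (cases T)
    \<comment> \<open>The lower branch alone, with \<open>a = 1\<close>, serves as \<open>V\<close>.
      The condition above the threshold is vacuous, so \<open>\<delta> = 1\<close> is arbitrary, and
      \<open>V D \<le> \<epsilon>\<close> is the lower boundary of the region.\<close>
    case PInf
    have "- ln \<epsilon> \<le> \<alpha>1 * D" using \<epsilon> a0 a1 by (simp add: ln_div field_simps)
    hence "- \<alpha>1 * D \<le> ln \<epsilon>" by simp
    hence "exp (- \<alpha>1 * D) \<le> exp (ln \<epsilon>)" by (rule iffD2[OF exp_le_cancel_iff])
    hence VD: "exp (- \<alpha>1 * D) \<le> \<epsilon>" by (simp only: exp_ln[OF \<epsilon>(1)])
    show ?thesis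
    proof (rule feasibleI[where V = "\<lambda>y. exp (- \<alpha>1 * y)" and \<delta> = 1])
      show "1 \<le> exp (- \<alpha>1 * y)" if "y < 0" for y
        using that a0 a1 by (simp add: mult_nonneg_nonpos)
      show "\<exists>c d. 0 \<le> c \<and> 0 \<le> d \<and> exp (- \<alpha>1 * y) = c * exp (- \<alpha>1 * y) + d \<and>
          (\<forall>z. exp (- \<alpha>1 * z) \<le> c * exp (- \<alpha>1 * z) + d)" for y
        by (rule exI[of _ 1], rule exI[of _ 0]) simp
    qed (use VD PInf in auto)
  next
    case MInf
    hence "Tstar \<alpha>0 \<alpha>1 D \<epsilon> = - \<infinity>" using assms(12) by simp
    thus ?thesis by (simp add: Tstar_def Tstar_large_def Tstar_small_def split: if_splits)
  next
    case (real \<tau>)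
    define \<beta> where "\<beta> = risky_beta \<alpha>0 \<alpha>1"
    define w where "w = exp (- \<alpha>1 * \<tau>)"
    define c where "c = \<beta> * w"
    \<comment> \<open>\<open>a\<close> solves \<open>a * w + (1 - a) = c\<close>, which joins the
      two branches continuously at \<open>\<tau>\<close>.\<close>
    define a where "a = (1 - c) / (1 - w)"
    define p where "p = 1 - \<alpha>0 / 2"
    note bounds = finite_threshold_bounds[OF a0 a1 assms(6,11) assms(12)[unfolded real],
        folded \<beta>_def, folded w_def, folded c_def, folded a_def]
    have \<beta>: "1 < \<beta>" unfolding \<beta>_def using a0 a1 assms(6) by (rule risky_beta_gt_1)
    have w: "0 < w" "w < 1" using bounds(1) a0 a1 by (simp_all add: w_def)
    have p: "0 < p" "p < 1" using assms(6) a0 by (simp_all add: p_def)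
    have c: "0 < c" "c < 1" "w < c" using bounds(2) \<beta> w by (simp_all add: c_def)
    have a: "0 \<le> a" "a \<le> 1" using c w by (simp_all add: a_def)
    have aw: "a * w + (1 - a) = c"
      using w(2) by (simp add: a_def divide_simps) (simp add: algebra_simps)
    \<comment> \<open>This identity explains the form of \<open>\<beta>\<close>: at
      \<open>\<tau>\<close> the lower branch falls at most \<open>p\<close> times as fast as the
      upper one. The margin \<open>p < 1\<close> buys domination down to the distance
      \<open>- ln p / \<alpha>1\<close> below \<open>\<tau>\<close>, which is the
      \<open>\<delta>\<close> used.\<close>
    have "w * \<alpha>1 = c * \<alpha>0 * p"
      using p a0 by (simp add: c_def \<beta>_def risky_beta_def p_def[symmetric])
    moreover have "a * w * \<alpha>1 \<le> 1 * w * \<alpha>1"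
      using a w a0 a1 by (intro mult_right_mono) simp_all
    ultimately have A: "a * w * \<alpha>1 \<le> c * \<alpha>0 * p" by simp
    hence A': "a * w * \<alpha>1 \<le> c * \<alpha>0" using p c a0
      by (smt (verit) mult_left_le mult_pos_pos)
    define V where "V y = (if y < \<tau> then a * exp (- \<alpha>1 * y) + (1 - a)
        else c * exp (\<alpha>0 * \<tau>) * exp (- \<alpha>0 * y))" for y
    have exp0: "c * exp (\<alpha>0 * \<tau>) * exp (- \<alpha>0 * y) = c * exp (- \<alpha>0 * (y - \<tau>))" for y
      by (simp add: mult.assoc exp_add[symmetric] algebra_simps)
    have exp1: "a * exp (- \<alpha>1 * y) = a * w * exp (- \<alpha>1 * (y - \<tau>))" for y
      by (simp add: w_def mult.assoc exp_add[symmetric] algebra_simps)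
    show ?thesis
    proof (rule feasibleI[where V = V and \<delta> = "- ln p / \<alpha>1"])
      show "V \<in> borel_measurable borel" unfolding V_def[abs_def] by measurable
      show "0 \<le> V y" for y using a c by (simp add: V_def)
      show "1 \<le> V y" if "y < 0" for y
      proof -
        have "1 \<le> exp (- \<alpha>1 * y)" using that a0 a1 by (simp add: mult_nonneg_nonpos)
        hence "a * 1 \<le> a * exp (- \<alpha>1 * y)" using a(1) by (rule mult_left_mono)
        thus ?thesis using that bounds(1) by (simp add: V_def)
      qed
      show "0 < - ln p / \<alpha>1" using p a0 a1 by (simp add: divide_neg_pos)
      show "\<exists>c d. 0 \<le> c \<and> 0 \<le> d \<and> V y = c * exp (- \<alpha>1 * y) + d \<and>
          (\<forall>z. V z \<le> c * exp (- \<alpha>1 * z) + d)" if "0 \<le> y" "ereal y < T" for y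
      proof (rule exI[of _ a], rule exI[of _ "1 - a"], intro conjI allI)
        fix z
        show "V z \<le> a * exp (- \<alpha>1 * z) + (1 - a)"
        proof (cases "z < \<tau>")
          case False
          \<comment> \<open>Above \<open>\<tau>\<close>, \<open>A'\<close> compares the slopes at
            \<open>\<tau>\<close>, and the larger exponent makes the lower branch flatten
            sooner.\<close>
          define s where "s = z - \<tau>"
          have s: "0 \<le> s" using False by (simp add: s_def)
          have "a * w * \<alpha>1 * (1 - exp (- \<alpha>1 * s)) \<le> c * \<alpha>0 * (1 - exp (- \<alpha>1 * s))"
            using A' s a0 a1 by (intro mult_right_mono) simp_all
          also have "\<dots> \<le> c * (\<alpha>1 * (1 - exp (- \<alpha>0 * s)))"
            using one_minus_exp_ratio_antimono[of \<alpha>0 \<alpha>1 s] a0 a1 s c by (simp add: mult.assoc)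
          finally have "\<alpha>1 * (a * w * (1 - exp (- \<alpha>1 * s))) \<le> \<alpha>1 * (c * (1 - exp (- \<alpha>0 * s)))"
            by (simp add: mult_ac)
          hence "a * w * (1 - exp (- \<alpha>1 * s)) \<le> c * (1 - exp (- \<alpha>0 * s))"
            using a0 a1 by (simp only: mult_le_cancel_left_pos less_trans[OF a0 a1])
          hence "c * exp (- \<alpha>0 * s) \<le> a * w * exp (- \<alpha>1 * s) + (1 - a)"
            using aw by (simp add: algebra_simps)
          thus ?thesis using False unfolding V_def exp0 exp1 s_def by simp
        qed (simp add: V_def)
      qed (use a that real in \<open>simp_all add: V_def\<close>)
      show "\<exists>c. 0 \<le> c \<and> V y = c * exp (- \<alpha>0 * y) \<and>
          (\<forall>z\<ge>y - - ln p / \<alpha>1. V z \<le> c * exp (- \<alpha>0 * z))" if "0 \<le> y" "T \<le> ereal y" for y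
      proof (intro exI[of _ "c * exp (\<alpha>0 * \<tau>)"] conjI allI impI)
        fix z assume z: "y - - ln p / \<alpha>1 \<le> z"
        show "V z \<le> c * exp (\<alpha>0 * \<tau>) * exp (- \<alpha>0 * z)"
        proof (cases "z < \<tau>")
          case True
          \<comment> \<open>As \<open>\<tau> \<le> y\<close>, a step of at most
            \<open>- ln p / \<alpha>1\<close> below \<open>y\<close> stays within that distance
            below \<open>\<tau>\<close>.\<close>
          define v where "v = \<tau> - z"
          have "0 \<le> v" "v \<le> - ln p / \<alpha>1" using True z that(2) real by (simp_all add: v_def)
          hence "a * w * (exp (\<alpha>1 * v) - 1) \<le> c * (exp (\<alpha>0 * v) - 1)"
            using A a w c p a0 a1 by (intro exp_minus_one_le_near_zero[where q = p]) simp_all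
          hence "a * w * exp (\<alpha>1 * v) + (1 - a) \<le> c * exp (\<alpha>0 * v)"
            using aw by (simp add: algebra_simps)
          moreover have "\<alpha>1 * v = - \<alpha>1 * (z - \<tau>)" "\<alpha>0 * v = - \<alpha>0 * (z - \<tau>)"
            by (simp_all add: v_def algebra_simps)
          ultimately show ?thesis using True unfolding V_def exp0 exp1 by simp
        qed (simp add: V_def)
      qed (use c that real in \<open>simp_all add: V_def\<close>)
      show "V D \<le> \<epsilon>"
        using bounds(3,4) unfolding V_def exp0 by (cases "D < \<tau>") simp_all
    qed
  qed
qed

end
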